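(* Let a group $G$ act without inversion on a CAT(0) cube complex $X$, and suppose $g\in G$ is hyperbolic. Then $M^{\mathrm{ess}}_g$ is finite-dimensional, with dimension bounded by the translation distance $\ell_g$ of $g$.
   Context: A half-space $H$ of $X$ is the closure of a component of the complement of a hyperplane, $\overline H$ the complementary half-space, and $\mathcal H(X)$ is ordered by inclusion. An action is without inversion if $gH\neq\overline H$ for all $g\in G$, $H\in\mathcal H(X)$. Distances between vertices are combinatorial. The translation distance of $g$ is $\ell_g=\min_x d(x,gx)$ ($x$ ranging over vertices) and $g$ is hyperbolic if $\ell_g>0$; then it has combinatorial axes (bi-infinite combinatorial geodesics preserved by $g$, on which $g$ translates by $\ell_g$, oriented forward). $A_g^+$ is the set of half-spaces dual to positively oriented edges of a combinatorial axis (independent of the axis; the half-space dual to an oriented edge $(x,y)$ contains $y$ but not $x$), and $A_g=A_g^+\sqcup\{\overline H:H\in A_g^+\}$. For a set $\mathcal A$ of half-spaces closed under $H\mapsto\overline H$, $X(\mathcal A)$ denotes the Sageev construction: vertices are subsets of $\mathcal A$ containing exactly one of each pair $\{H,\overline H\}$, no two elements disjoint, satisfying the descending chain condition; vertices differing on exactly one pair span an edge; cubes are attached whenever their $1$-skeleta are present. The essential characteristic set is $X^{\mathrm{ess}}_g=X(A_g)$, a CAT(0) cube complex whose half-spaces are identified with $A_g$. $M_g$ is the full subcomplex of $X$ spanned by the vertices realizing $\ell_g$, and $X_g$ is its convex hull. Let $T_g$ be the set of half-spaces not in $A_g$ whose bounding hyperplane separates two combinatorial axes of $g$, and $X^{\mathrm{ell}}_g=X(T_g)$.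 There is a $\langle g\rangle$-equivariant isomorphism $X_g\cong X^{\mathrm{ess}}_g\times X^{\mathrm{ell}}_g$ (send a vertex $v$, regarded as the set of half-spaces containing it, to its intersections with $A_g$ and $T_g$). The essential minimal set $M^{\mathrm{ess}}_g\subseteq X^{\mathrm{ess}}_g$ is the image of $M_g$ under projection to the first factor. *)

theory Defs
  imports "HOL-Library.Extended_Nat" "HOL-Algebra.Group_Action"
begin

section \<open>CAT(0) cube complexes\<close>

text \<open>
  A cube complex is encoded, like an abstract simplicial complex, by the set \<open>X\<close> of the
  vertex sets of its cubes; its vertex set is \<open>\<Union>X\<close>. A chart identifies the vertices of an
  $n$-cube with the subsets of \<open>{..<n}\<close>; its faces are then the intervals of this Boolean lattice,
  and these are required to be exactly the cubes of \<open>X\<close> contained in the given one. Cubes are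
  embedded and meet in common faces, which is automatic for CAT(0) cube complexes. There is no
  bound on the dimensions of the cubes, and no local finiteness is assumed.
\<close>

definition cube_faces :: "nat \<Rightarrow> nat set set set" where
  "cube_faces n = {{S. A \<subseteq> S \<and> S \<subseteq> B} | A B. A \<subseteq> B \<and> B \<subseteq> {..<n}}"

definition cube_chart :: "'a set set \<Rightarrow> nat \<Rightarrow> (nat set \<Rightarrow> 'a) \<Rightarrow> 'a set \<Rightarrow> bool" where
  "cube_chart X n c C \<longleftrightarrow>
     bij_betw c (Pow {..<n}) C \<and> {D \<in> X. D \<subseteq> C} = image c ` cube_faces n"

definition cube_complex :: "'a set set \<Rightarrow> bool" where
  "cube_complex X \<longleftrightarrow>
     (\<forall>C\<in>X. \<exists>n c. cube_chart X n c C) \<and>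
     (\<forall>C\<in>X. \<forall>D\<in>X. C \<inter> D \<noteq> {} \<longrightarrow> C \<inter> D \<in> X)"

definition adj :: "'a set set \<Rightarrow> 'a \<Rightarrow> 'a \<Rightarrow> bool" where
  "adj X x y \<longleftrightarrow> x \<noteq> y \<and> {x, y} \<in> X"

definition edge_path :: "'a set set \<Rightarrow> 'a list \<Rightarrow> bool" where
  "edge_path X p \<longleftrightarrow> p \<noteq> [] \<and> set p \<subseteq> \<Union>X \<and> successively (adj X) p"

text \<open>
  Simple connectedness is expressed through the edge-path group: a closed edge path must be
  contractible by inserting and removing backtracks and by pushing it across squares.
\<close>

inductive elementary_homotopy :: "'a set set \<Rightarrow> 'a list \<Rightarrow> 'a list \<Rightarrow> bool" for X where
  backtrack: "adj X x y \<Longrightarrow>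
    elementary_homotopy X (us @ [x] @ vs) (us @ [x, y, x] @ vs)"
| square: "\<lbrakk>{x, y, z, w} \<in> X; distinct [x, y, z, w];
     adj X x y; adj X y z; adj X z w; adj X w x\<rbrakk> \<Longrightarrow>
    elementary_homotopy X (us @ [x, y, z] @ vs) (us @ [x, w, z] @ vs)"

definition simply_connected_complex :: "'a set set \<Rightarrow> bool" where
  "simply_connected_complex X \<longleftrightarrow>
     \<Union>X \<noteq> {} \<and>
     (\<forall>x\<in>\<Union>X. \<forall>y\<in>\<Union>X. \<exists>p. edge_path X p \<and> hd p = x \<and> last p = y) \<and>
     (\<forall>p. edge_path X p \<and> hd p = last p \<longrightarrow> equivclp (elementary_homotopy X) p [hd p])"

text \<open>
  The vertices of the link of \<open>v\<close> are represented by the neighbours of \<open>v\<close>; a cube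
  containing \<open>v\<close> spans the simplex of those neighbours that it contains (so the link includes the
  empty simplex).
\<close>

definition vertex_link :: "'a set set \<Rightarrow> 'a \<Rightarrow> 'a set set" where
  "vertex_link X v = {{w \<in> C. adj X v w} | C. C \<in> X \<and> v \<in> C}"

definition flag :: "'a set set \<Rightarrow> bool" where
  "flag L \<longleftrightarrow>
     (\<forall>S. finite S \<and> S \<subseteq> \<Union>L \<and> (\<forall>x\<in>S. \<forall>y\<in>S. {x, y} \<in> L) \<longrightarrow> S \<in> L)"

definition CAT0_cube_complex :: "'a set set \<Rightarrow> bool" where
  "CAT0_cube_complex X \<longleftrightarrow>
     cube_complex X \<and> simply_connected_complex X \<and> (\<forall>v\<in>\<Union>X. flag (vertex_link X v))"

text \<open>The unspecified value of \<open>cube_dim\<close> is never used for cubes, which have $2^n$ vertices.\<close>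

definition cube_dim :: "'a set \<Rightarrow> nat" where
  "cube_dim C = (THE n. card C = 2 ^ n)"

definition complex_dim :: "'a set set \<Rightarrow> enat" where
  "complex_dim X = (SUP C\<in>X. enat (cube_dim C))"

definition finite_dimensional :: "'a set set \<Rightarrow> bool" where
  "finite_dimensional X \<longleftrightarrow> (\<exists>d. \<forall>C\<in>X. cube_dim C \<le> d)"


section \<open>Hyperplanes and half-spaces\<close>

text \<open>
  A hyperplane is given by the set of edges it is dual to, i.e. a class for the equivalence relation
  generated by being opposite edges of a square. (Two disjoint edges whose union is a cube are
  opposite edges of that square; \<open>opposite\<close> is symmetric.)
\<close>

definition edges :: "'a set set \<Rightarrow> 'a set set" where
  "edges X = {e \<in> X. card e = 2}"

definition opposite :: "'a set set \<Rightarrow> 'a set \<Rightarrow> 'a set \<Rightarrow> bool" where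
  "opposite X e e' \<longleftrightarrow> e \<in> edges X \<and> e' \<in> edges X \<and> e \<inter> e' = {} \<and> e \<union> e' \<in> X"

definition hyperplane_of :: "'a set set \<Rightarrow> 'a set \<Rightarrow> 'a set set" where
  "hyperplane_of X e = {e'. (opposite X)\<^sup>*\<^sup>* e e'}"

definition hyperplanes :: "'a set set \<Rightarrow> 'a set set set" where
  "hyperplanes X = hyperplane_of X ` edges X"

text \<open>
  A half-space is represented by its set of vertices. Vertices lie in the same component of the
  complement of a hyperplane iff they are joined by an edge path that does not cross it.
\<close>

definition component_avoiding :: "'a set set \<Rightarrow> 'a set set \<Rightarrow> 'a \<Rightarrow> 'a set" where
  "component_avoiding X h x = {y. (\<lambda>u v. adj X u v \<and> {u, v} \<notin> h)\<^sup>*\<^sup>* x y}"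

definition sides :: "'a set set \<Rightarrow> 'a set set \<Rightarrow> 'a set set" where
  "sides X h = component_avoiding X h ` \<Union>X"

definition halfspaces :: "'a set set \<Rightarrow> 'a set set" where
  "halfspaces X = (\<Union>h\<in>hyperplanes X. sides X h)"

definition opp_halfspace :: "'a set set \<Rightarrow> 'a set \<Rightarrow> 'a set" where
  "opp_halfspace X H = \<Union>X - H"

definition dual_halfspaces :: "'a set set \<Rightarrow> 'a \<Rightarrow> 'a \<Rightarrow> 'a set set" where
  "dual_halfspaces X x y = {H \<in> sides X (hyperplane_of X {x, y}). y \<in> H \<and> x \<notin> H}"


section \<open>Group actions and translation distance\<close>

definition cubical_action :: "('g, 'm) monoid_scheme \<Rightarrow> 'a set set \<Rightarrow> ('g \<Rightarrow> 'a \<Rightarrow> 'a) \<Rightarrow> bool" where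
  "cubical_action G X act \<longleftrightarrow>
     group_action G (\<Union>X) act \<and> (\<forall>g\<in>carrier G. \<forall>C\<in>X. act g ` C \<in> X)"

definition without_inversion :: "('g, 'm) monoid_scheme \<Rightarrow> 'a set set \<Rightarrow> ('g \<Rightarrow> 'a \<Rightarrow> 'a) \<Rightarrow> bool" where
  "without_inversion G X act \<longleftrightarrow>
     (\<forall>g\<in>carrier G. \<forall>H\<in>halfspaces X. act g ` H \<noteq> opp_halfspace X H)"

definition cdist :: "'a set set \<Rightarrow> 'a \<Rightarrow> 'a \<Rightarrow> nat" where
  "cdist X x y = (LEAST n. \<exists>p. edge_path X p \<and> hd p = x \<and> last p = y \<and> length p = Suc n)"

text \<open>From here on, \<open>f\<close> is the map by which a group element acts on the vertices.\<close>

definition translation_distance :: "'a set set \<Rightarrow> ('a \<Rightarrow> 'a) \<Rightarrow> nat" where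
  "translation_distance X f = (INF x\<in>\<Union>X. cdist X x (f x))"

definition hyperbolic :: "'a set set \<Rightarrow> ('a \<Rightarrow> 'a) \<Rightarrow> bool" where
  "hyperbolic X f \<longleftrightarrow> translation_distance X f > 0"

definition combinatorial_axis :: "'a set set \<Rightarrow> ('a \<Rightarrow> 'a) \<Rightarrow> (int \<Rightarrow> 'a) \<Rightarrow> bool" where
  "combinatorial_axis X f \<gamma> \<longleftrightarrow>
     range \<gamma> \<subseteq> \<Union>X \<and>
     (\<forall>i j. cdist X (\<gamma> i) (\<gamma> j) = nat \<bar>i - j\<bar>) \<and>
     (\<forall>i. f (\<gamma> i) = \<gamma> (i + int (translation_distance X f)))"


section \<open>The essential characteristic set and the essential minimal set\<close>

text \<open>All axes yield the same half-spaces, so \<open>pos_halfspaces\<close> may range over all of them.\<close>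

definition pos_halfspaces :: "'a set set \<Rightarrow> ('a \<Rightarrow> 'a) \<Rightarrow> 'a set set" where
  "pos_halfspaces X f =
     {H. \<exists>\<gamma> i. combinatorial_axis X f \<gamma> \<and> H \<in> dual_halfspaces X (\<gamma> i) (\<gamma> (i + 1))}"

definition ess_halfspaces :: "'a set set \<Rightarrow> ('a \<Rightarrow> 'a) \<Rightarrow> 'a set set" where
  "ess_halfspaces X f = pos_halfspaces X f \<union> opp_halfspace X ` pos_halfspaces X f"

definition sageev_vertices :: "'a set set \<Rightarrow> 'a set set \<Rightarrow> 'a set set set" where
  "sageev_vertices X \<A> = {v. v \<subseteq> \<A> \<and>
     (\<forall>H\<in>\<A>. H \<in> v \<longleftrightarrow> opp_halfspace X H \<notin> v) \<and>
     (\<forall>H\<in>v. \<forall>K\<in>v. H \<inter> K \<noteq> {}) \<and>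
     \<not> (\<exists>c :: nat \<Rightarrow> 'a set. range c \<subseteq> v \<and> (\<forall>n. c (Suc n) \<subset> c n))}"

definition sageev_adj :: "'a set set \<Rightarrow> 'a set set \<Rightarrow> 'a set set \<Rightarrow> bool" where
  "sageev_adj X v w \<longleftrightarrow> (\<exists>H\<in>v. w = insert (opp_halfspace X H) (v - {H}))"

definition sageev_complex :: "'a set set \<Rightarrow> 'a set set \<Rightarrow> 'a set set set set" where
  "sageev_complex X \<A> = {C. C \<subseteq> sageev_vertices X \<A> \<and>
     (\<exists>(n::nat) c. bij_betw c (Pow {..<n}) C \<and>
       (\<forall>S \<subseteq> {..<n}. \<forall>i \<in> {..<n} - S. sageev_adj X (c S) (c (insert i S))))}"

definition ess_characteristic_set :: "'a set set \<Rightarrow> ('a \<Rightarrow> 'a) \<Rightarrow> 'a set set set set" where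
  "ess_characteristic_set X f = sageev_complex X (ess_halfspaces X f)"

definition minimal_set :: "'a set set \<Rightarrow> ('a \<Rightarrow> 'a) \<Rightarrow> 'a set set" where
  "minimal_set X f = {C \<in> X. \<forall>x\<in>C. cdist X x (f x) = translation_distance X f}"

text \<open>
  The projection of the convex hull of the minimal set to its essential factor sends a vertex,
  viewed as the set of half-spaces containing it, to its intersection with \<open>ess_halfspaces\<close>.
  A cube of the product is a product of cubes, so it is mapped onto a cube, and the cubes of the
  image of a subcomplex are the images of its cubes.
\<close>

definition ess_projection :: "'a set set \<Rightarrow> ('a \<Rightarrow> 'a) \<Rightarrow> 'a \<Rightarrow> 'a set set" where
  "ess_projection X f v = {H \<in> halfspaces X. v \<in> H} \<inter> ess_halfspaces X f"

definition ess_minimal_set :: "'a set set \<Rightarrow> ('a \<Rightarrow> 'a) \<Rightarrow> 'a set set set set" where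
  "ess_minimal_set X f = image (ess_projection X f) ` minimal_set X f"

end

theory Submission imports Defs begin

text \<open>
  Edge paths are compared up to pushing them across squares. By the flag condition, edges act on
  reduced paths up to such swaps, and simple connectedness makes the resulting normal form of a
  path depend on its endpoints only. Hence geodesics with the same ends differ by swaps, which gives
  the quadrangle condition: two neighbours of \<open>x\<close> that are closer to \<open>b\<close> than \<open>x\<close> span a square with
  a fourth vertex closer still. It follows that the two sides of the hyperplane dual to an edge
  consist of the vertices nearer to one of its ends than to the other.

  For the bound, let \<open>C\<close> be a cube of the minimal set and let \<open>v\<close> be the vertex of \<open>C\<close> outside all
  the positively oriented half-spaces of $A_g^+$ whose hyperplanes cross \<open>C\<close>. Let \<open>w\<close> be the
  neighbour of \<open>v\<close> across such a half-space \<open>H\<close>. As \<open>w\<close> has minimal displacement, its orbit moves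
  along a geodesic and cannot leave \<open>H\<close> again, so $gw \in H$. Since $gv$ and $gw$ are separated by
  $gH \neq H$ only, also $gv \in H$. So the number of these half-spaces, which is the dimension of
  the projection of \<open>C\<close>, is at most $d(v, gv) = \ell_g$.
\<close>

section \<open>Squares with their vertices in cyclic order\<close>

definition sq :: "'a set set \<Rightarrow> 'a \<Rightarrow> 'a \<Rightarrow> 'a \<Rightarrow> 'a \<Rightarrow> bool" where
  "sq X x y z w \<longleftrightarrow> {x, y, z, w} \<in> X \<and> distinct [x, y, z, w] \<and>
     adj X x y \<and> adj X y z \<and> adj X z w \<and> adj X w x"

lemma adj_sym: "adj X x y \<Longrightarrow> adj X y x"
  by (auto simp: adj_def insert_commute)

lemma adj_commute: "adj X x y \<longleftrightarrow> adj X y x"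
  by (metis adj_sym)

lemma adj_in: "adj X x y \<Longrightarrow> x \<in> \<Union>X" "adj X x y \<Longrightarrow> y \<in> \<Union>X"
  by (auto simp: adj_def)

lemma sq_rotate: "sq X x y z w \<Longrightarrow> sq X y z w x"
  by (auto simp: sq_def insert_commute)

lemma sq_flip: "sq X x y z w \<Longrightarrow> sq X x w z y"
  by (auto simp: sq_def insert_commute adj_commute)

lemma sq_swap: "sq X x y z w \<Longrightarrow> sq X y x w z"
  by (auto simp: sq_def insert_commute adj_commute)

lemma sq_adj:
  assumes "sq X x y z w"
  shows "adj X x y" "adj X y z" "adj X z w" "adj X w x"
    "adj X y x" "adj X z y" "adj X w z" "adj X x w"
  using assms by (auto simp: sq_def adj_commute)

lemma sq_distinct: "sq X x y z w \<Longrightarrow> distinct [x, y, z, w]"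
  by (simp add: sq_def)


section \<open>Cubes\<close>

text \<open>Reflecting the Boolean lattice in the coordinates \<open>S0\<close> keeps the free
  coordinates \<open>B - A\<close> of an interval and flips those fixed ones that lie in
  \<open>S0\<close>.\<close>

lemma sym_diff_cube_face:
  assumes "F \<in> cube_faces n" "S0 \<subseteq> {..<n}"
  shows "(\<lambda>S. sym_diff S S0) ` F \<in> cube_faces n"
proof -
  obtain A B where AB: "A \<subseteq> B" "B \<subseteq> {..<n}" "F = {S. A \<subseteq> S \<and> S \<subseteq> B}"
    using assms(1) by (auto simp: cube_faces_def)
  define A' where "A' = sym_diff A S0 - (B - A)"
  define B' where "B' = sym_diff A S0 \<union> (B - A)"
  have "(\<lambda>S. sym_diff S S0) ` F = {S. A' \<subseteq> S \<and> S \<subseteq> B'}"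
  proof (intro equalityI subsetI)
    fix T assume "T \<in> {S. A' \<subseteq> S \<and> S \<subseteq> B'}"
    then have "sym_diff T S0 \<in> F" "T = sym_diff (sym_diff T S0) S0"
      using AB(1,2) by (auto simp: AB(3) A'_def B'_def)
    then show "T \<in> (\<lambda>S. sym_diff S S0) ` F" by blast
  qed (use AB(1) in \<open>auto simp: AB(3) A'_def B'_def\<close>)
  moreover have "A' \<subseteq> B'" "B' \<subseteq> {..<n}"
    using AB(1,2) assms(2) by (auto simp: A'_def B'_def)
  ultimately show ?thesis by (auto simp: cube_faces_def)
qed

text \<open>Reflected charts allow any vertex of a cube to play the role of the origin
  \<open>{}\<close>.\<close>

lemma cube_chart_sym_diff:
  assumes "cube_chart X n c C" "S0 \<subseteq> {..<n}"
  shows "cube_chart X n (\<lambda>S. c (sym_diff S S0)) C"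
proof -
  let ?s = "\<lambda>S. sym_diff S S0"
  have inv: "?s (?s S) = S" for S by auto
  have "bij_betw ?s (Pow {..<n}) (Pow {..<n})"
    by (rule bij_betw_byWitness[where f' = ?s]) (use assms(2) in auto)
  then have bij: "bij_betw (c \<circ> ?s) (Pow {..<n}) C"
    by (rule bij_betw_trans) (use assms(1) in \<open>simp add: cube_chart_def\<close>)
  have faces: "image ?s ` cube_faces n = cube_faces n"
  proof (intro equalityI subsetI)
    fix F assume F: "F \<in> cube_faces n"
    have "?s ` ?s ` F = F" unfolding image_image inv by simp
    then show "F \<in> image ?s ` cube_faces n"
      using sym_diff_cube_face[OF F assms(2)] by (intro image_eqI[where x = "?s ` F"]) simp_all
  next
    fix F assume "F \<in> image ?s ` cube_faces n"
    then show "F \<in> cube_faces n"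
      by (rule imageE) (simp only: sym_diff_cube_face[OF _ assms(2)])
  qed
  have "image (c \<circ> ?s) ` cube_faces n = image c ` image ?s ` cube_faces n"
    unfolding image_image by simp
  then have faces':  "image (c \<circ> ?s) ` cube_faces n = image c ` cube_faces n"
    unfolding faces .
  have "{D \<in> X. D \<subseteq> C} = image c ` cube_faces n"
    using assms(1) by (simp only: cube_chart_def)
  then show ?thesis
    unfolding cube_chart_def comp_def[symmetric, of c ?s] faces' using bij by simp
qed

lemma cube_chart_face:
  assumes "cube_chart X n c C" "A \<subseteq> B" "B \<subseteq> {..<n}"
  shows "c ` {S. A \<subseteq> S \<and> S \<subseteq> B} \<in> X"
proof -
  have "c ` {S. A \<subseteq> S \<and> S \<subseteq> B} \<in> image c ` cube_faces n"
    using assms(2,3) by (auto simp: cube_faces_def)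
  then show ?thesis using assms(1) by (auto simp: cube_chart_def)
qed

lemma cube_chart_inj:
  assumes "cube_chart X n c C" "S \<subseteq> {..<n}" "T \<subseteq> {..<n}"
  shows "c S = c T \<longleftrightarrow> S = T"
  using assms by (auto simp: cube_chart_def bij_betw_def inj_on_def)

lemma cube_chart_adj:
  assumes "cube_chart X n c C" "insert i S \<subseteq> {..<n}" "i \<notin> S"
  shows "adj X (c S) (c (insert i S))"
proof -
  have "{T. S \<subseteq> T \<and> T \<subseteq> insert i S} = {S, insert i S}" by auto
  then have "{c S, c (insert i S)} \<in> X"
    using cube_chart_face[OF assms(1) subset_insertI assms(2)] by simp
  moreover have "c S \<noteq> c (insert i S)"
    using cube_chart_inj[OF assms(1)] assms(2,3) by auto
  ultimately show ?thesis by (simp add: adj_def)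
qed

lemma cube_chart_sq:
  assumes "cube_chart X n c C" "insert i (insert j S) \<subseteq> {..<n}" "i \<notin> S" "j \<notin> S" "i \<noteq> j"
  shows "sq X (c S) (c (insert i S)) (c (insert i (insert j S))) (c (insert j S))"
proof -
  let ?U = "insert i (insert j S)"
  have "{T. S \<subseteq> T \<and> T \<subseteq> ?U} = {S, insert i S, ?U, insert j S}"
  proof (intro equalityI subsetI)
    fix T assume T: "T \<in> {T. S \<subseteq> T \<and> T \<subseteq> ?U}"
    show "T \<in> {S, insert i S, ?U, insert j S}"
    proof (cases "i \<in> T")
      case True
      then have "T = insert i S \<or> T = ?U" using T by (cases "j \<in> T") blast+
      then show ?thesis by blast
    next
      case False
      then have "T = S \<or> T = insert j S" using T by (cases "j \<in> T") blast+
      then show ?thesis by blast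
    qed
  qed auto
  then have "{c S, c (insert i S), c ?U, c (insert j S)} \<in> X"
    using cube_chart_face[OF assms(1) _ assms(2), of S] by (simp add: subset_insertI2)
  moreover have "adj X (c S) (c (insert i S))"
    by (rule cube_chart_adj[OF assms(1)]) (use assms(2-) in auto)
  moreover have "adj X (c (insert j S)) (c S)"
    by (rule adj_sym, rule cube_chart_adj[OF assms(1)]) (use assms(2-) in auto)
  moreover have "adj X (c ?U) (c (insert j S))"
    by (rule adj_sym, rule cube_chart_adj[OF assms(1)]) (use assms(2-) in auto)
  moreover have "adj X (c (insert i S)) (c ?U)"
    unfolding insert_commute[of i j S]
    by (rule cube_chart_adj[OF assms(1)]) (use assms(2-) in auto)
  moreover have "distinct [S, insert i S, ?U, insert j S]"
    using assms(3-) by auto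
  then have "distinct [c S, c (insert i S), c ?U, c (insert j S)]"
    using cube_chart_inj[OF assms(1)] assms(2) by simp
  ultimately show ?thesis by (simp add: sq_def)
qed

text \<open>The edge is a face, so \<open>{{}, T}\<close> is an interval, where \<open>T\<close> are
  the coordinates of \<open>w\<close>. It contains \<open>{i}\<close> for each
  \<open>i \<in> T\<close>, which makes \<open>T\<close> a singleton.\<close>

lemma cube_chart_neighbour:
  assumes "cube_chart X n c C" "w \<in> C" "adj X (c {}) w"
  shows "\<exists>i<n. w = c {i}"
proof -
  obtain T where T: "T \<subseteq> {..<n}" "w = c T"
    using assms(1,2) by (auto simp: cube_chart_def bij_betw_def)
  have "c {} \<in> C" using assms(1) by (auto simp: cube_chart_def bij_betw_def)
  then have "{c {}, w} \<in> image c ` cube_faces n"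
    using assms by (auto simp: cube_chart_def adj_def)
  then obtain A B where AB: "A \<subseteq> B" "B \<subseteq> {..<n}" "c ` {{}, T} = c ` {S. A \<subseteq> S \<and> S \<subseteq> B}"
    by (auto simp: cube_faces_def T(2))
  have "inj_on c (Pow {..<n})" using assms(1) by (auto simp: cube_chart_def bij_betw_def)
  then have eq: "{{}, T} = {S. A \<subseteq> S \<and> S \<subseteq> B}"
    using AB T by (subst (asm) inj_on_image_eq_iff) auto
  have "T \<noteq> {}" using assms(3) T by (auto simp: adj_def)
  then obtain i where i: "i \<in> T" by auto
  have "A = {}" "T \<subseteq> B" using eq by auto
  then have "{i} \<in> {{}, T}" using i eq by auto
  then show ?thesis using T by auto
qed

section \<open>Squares and 3-cubes in a CAT(0) cube complex\<close>

locale CAT0 =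
  fixes X :: "'a set set"
  assumes CAT0: "CAT0_cube_complex X"
begin

abbreviation d :: "'a \<Rightarrow> 'a \<Rightarrow> nat" where "d \<equiv> cdist X"

lemma rebased_chart:
  assumes "C \<in> X" "v \<in> C"
  obtains n c where "cube_chart X n c C" "c {} = v"
proof -
  obtain n c where c: "cube_chart X n c C"
    using CAT0 assms(1) by (auto simp: CAT0_cube_complex_def cube_complex_def)
  obtain S0 where "S0 \<subseteq> {..<n}" "v = c S0"
    using c assms(2) by (auto simp: cube_chart_def bij_betw_def)
  then show thesis
    using that[OF cube_chart_sym_diff[OF c]] by simp
qed

lemma card_cube:
  assumes "C \<in> X"
  shows "\<exists>n. card C = 2 ^ n"
proof -
  obtain n c where "cube_chart X n c C"
    using CAT0 assms(1) by (auto simp: CAT0_cube_complex_def cube_complex_def)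
  then have "bij_betw c (Pow {..<n}) C" by (simp add: cube_chart_def)
  then have "card C = card (Pow {..<n})" using bij_betw_same_card by metis
  then show ?thesis by (auto simp: card_Pow)
qed

lemma cube_inter:
  assumes "C \<in> X" "D \<in> X" "C \<inter> D \<noteq> {}"
  shows "C \<inter> D \<in> X"
  using CAT0 assms by (simp add: CAT0_cube_complex_def cube_complex_def)

text \<open>Two different squares sharing three corners would meet in a cube with three vertices,
  but 3 is not a power of two.\<close>

lemma sq_unique:
  assumes "sq X x y z w" "sq X x y z w'"
  shows "w = w'"
proof (rule ccontr)
  assume "w \<noteq> w'"
  with assms have "{x, y, z, w} \<inter> {x, y, z, w'} = {x, y, z}" "card {x, y, z} = 3"
    by (auto simp: sq_def)
  moreover have "{x, y, z, w} \<inter> {x, y, z, w'} \<in> X"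
    using assms by (intro cube_inter) (auto simp: sq_def)
  ultimately obtain n where n: "3 = (2::nat) ^ n"
    using card_cube by metis
  then have "n \<noteq> 0" by (cases n) auto
  then have "even ((2::nat) ^ n)" by simp
  then have "even (3::nat)" using n by metis
  then show False by simp
qed

lemma sq_unique': "sq X x y z w \<Longrightarrow> sq X x y z' w \<Longrightarrow> z = z'"
  by (rule sq_unique; rule sq_rotate; rule sq_rotate; rule sq_rotate)

text \<open>The squares make \<open>a\<close>, \<open>b\<close>, \<open>c\<close> pairwise adjacent
  in the link of \<open>v\<close>, so by the flag condition some cube contains all of them and
  \<open>v\<close>. In its 3-face spanned by these edges, \<open>e\<close> is the corner opposite to
  \<open>v\<close>.\<close>

lemma sq_cube:
  assumes "sq X v a ab b" "sq X v b bc c" "sq X v a ac c"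
  shows "\<exists>e. sq X ab b bc e \<and> sq X ab a ac e \<and> sq X ac c bc e"
proof -
  have ne: "a \<noteq> b" "b \<noteq> c" "a \<noteq> c"
    using assms by (auto simp: sq_def)
  have v: "v \<in> \<Union>X" using assms(1) by (auto simp: sq_def)
  \<comment> \<open>A square has no diagonal edge, as its two coordinates give \<open>x\<close> only
    two neighbours in it. Hence the link simplex of a square at \<open>v\<close> consists of exactly
    the two expected vertices.\<close>
  have nadj: "\<not> adj X x z" if s: "sq X x y z w" for x y z w
  proof
    assume "adj X x z"
    obtain n h where h: "cube_chart X n h {x, y, z, w}" "h {} = x"
      by (rule rebased_chart[of "{x, y, z, w}" x]) (use s in \<open>auto simp: sq_def\<close>)
    have nb: "\<exists>i<n. u = h {i}" if "u \<in> {x, y, z, w}" "adj X x u" for u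
      using cube_chart_neighbour[OF h(1)] that h(2) by metis
    obtain i j k where ijk: "i < n" "j < n" "k < n" "y = h {i}" "z = h {j}" "w = h {k}"
      using nb[of y] nb[of z] nb[of w] \<open>adj X x z\<close> sq_adj(1,8)[OF s] by blast
    have "card (Pow {..<n}) = card {x, y, z, w}"
      using h(1) bij_betw_same_card unfolding cube_chart_def by metis
    also have "\<dots> = 4" using s by (simp add: sq_def)
    finally have "(2::nat) ^ n = 2 ^ 2" by (simp add: card_Pow)
    then have "n = 2" by (rule power_inject_exp[THEN iffD1, rotated]) simp
    then have "i = j \<or> j = k \<or> i = k" using ijk by linarith
    then show False using ijk s by (auto simp: sq_def)
  qed
  have link: "{p, q} \<in> vertex_link X v" if s: "sq X v p pq q" for p q pq
  proof -
    have "{u \<in> {v, p, pq, q}. adj X v u} = {p, q}"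
      using sq_adj[OF s] nadj[OF s] by (auto simp: adj_def)
    then show ?thesis using s unfolding vertex_link_def sq_def by blast
  qed
  have link1: "{p, p} \<in> vertex_link X v" if "adj X v p" for p
  proof -
    have "{u \<in> {v, p}. adj X v u} = {p, p}" using that by (auto simp: adj_def)
    then show ?thesis using that unfolding vertex_link_def adj_def by blast
  qed
  have "{a, b, c} \<in> vertex_link X v"
  proof -
    have "flag (vertex_link X v)" using CAT0 v unfolding CAT0_cube_complex_def by blast
    moreover have "{p, q} \<in> vertex_link X v" if pq: "p \<in> {a, b, c}" "q \<in> {a, b, c}" for p q
    proof -
      have "adj X v a" "adj X v b" "adj X v c"
        using sq_adj(8,1)[OF assms(1)] sq_adj(8)[OF assms(2)] by auto
      then have l: "{a, a} \<in> vertex_link X v" "{b, b} \<in> vertex_link X v" "{c, c} \<in> vertex_link X v"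
        by (simp_all only: link1)
      show ?thesis
        using pq
        by (elim insertE emptyE; hypsubst)
          (simp_all only: l link[OF assms(1)] link[OF assms(2)] link[OF assms(3)]
            link[OF sq_flip[OF assms(1)]] link[OF sq_flip[OF assms(2)]] link[OF sq_flip[OF assms(3)]])
    qed
    moreover from this have "\<forall>p\<in>{a, b, c}. \<forall>q\<in>{a, b, c}. {p, q} \<in> vertex_link X v" by fast
    moreover from this have "{a, b, c} \<subseteq> \<Union>(vertex_link X v)" by auto
    moreover have "finite {a, b, c}" by simp
    ultimately show ?thesis unfolding flag_def by metis
  qed
  then obtain C where C: "C \<in> X" "v \<in> C" "{a, b, c} = {w \<in> C. adj X v w}"
    by (auto simp: vertex_link_def)
  obtain n h where h: "cube_chart X n h C" "h {} = v"
    using rebased_chart[OF C(1,2)] .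
  have nb: "\<exists>i<n. u = h {i}" if "u \<in> {a, b, c}" for u
    using cube_chart_neighbour[OF h(1), of u] that unfolding h(2) C(3) by simp
  obtain i j k where ijk: "i < n" "j < n" "k < n" "a = h {i}" "b = h {j}" "c = h {k}"
    using nb[of a] nb[of b] nb[of c] by auto
  have ne': "i \<noteq> j" "j \<noteq> k" "i \<noteq> k" using ne ijk by auto
  have "sq X v a (h {i, j}) b" "sq X v b (h {j, k}) c" "sq X v a (h {i, k}) c"
    using cube_chart_sq[OF h(1), of i j "{}"] cube_chart_sq[OF h(1), of j k "{}"]
      cube_chart_sq[OF h(1), of i k "{}"] ne' ijk(1-3) unfolding h(2) ijk(4-6) by simp_all
  \<comment> \<open>The given squares share three corners with those of the chart.\<close>
  then have eqs: "ab = h {i, j}" "bc = h {j, k}" "ac = h {i, k}"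
    using sq_unique' assms by blast+
  have "sq X (h {j}) (h {i, j}) (h {i, j, k}) (h {j, k})"
    using cube_chart_sq[OF h(1), of i k "{j}"] ne' ijk(1-3) by (simp add: insert_commute)
  then have 1: "sq X ab b bc (h {i, j, k})" unfolding eqs(1,2) ijk(5) by (rule sq_swap)
  have "sq X (h {i}) (h {i, j}) (h {i, j, k}) (h {i, k})"
    using cube_chart_sq[OF h(1), of j k "{i}"] ne' ijk(1-3) by (simp add: insert_commute)
  then have 2: "sq X ab a ac (h {i, j, k})" unfolding eqs(1,3) ijk(4) by (rule sq_swap)
  have "sq X (h {k}) (h {i, k}) (h {i, j, k}) (h {j, k})"
    using cube_chart_sq[OF h(1), of i j "{k}"] ne' ijk(1-3) by (simp add: insert_commute)
  then have 3: "sq X ac c bc (h {i, j, k})" unfolding eqs(2,3) ijk(6) by (rule sq_swap)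
  show ?thesis by (rule exI[of _ "h {i, j, k}"]) (simp only: 1 2 3 simp_thms)
qed

end


section \<open>Paths up to square swaps\<close>

text \<open>Unlike in \<open>elementary_homotopy\<close>, backtracks are left out, so a swap
  preserves the length of a path.\<close>

inductive swap :: "'a set set \<Rightarrow> 'a list \<Rightarrow> 'a list \<Rightarrow> bool" for X where
  swap_here: "sq X x y z w \<Longrightarrow> swap X (x # y # z # p) (x # w # z # p)"
| swap_Cons: "swap X p q \<Longrightarrow> swap X (x # p) (x # q)"

inductive backtracks :: "'a list \<Rightarrow> bool" where
  backtracks_here: "backtracks (x # y # x # p)"
| backtracks_Cons: "backtracks p \<Longrightarrow> backtracks (x # p)"

inductive_simps backtracks_Cons_iff: "backtracks (x # p)"
inductive_cases backtracks_NilE [elim!]: "backtracks []"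

lemma swap_sym: "swap X p q \<Longrightarrow> swap X q p"
  by (induction rule: swap.induct) (auto intro: swap.intros sq_flip)

lemma swap_length: "swap X p q \<Longrightarrow> length p = length q"
  by (induction rule: swap.induct) auto

lemma swap_hd: "swap X p q \<Longrightarrow> p \<noteq> [] \<and> q \<noteq> [] \<and> hd p = hd q"
  by (induction rule: swap.induct) auto

lemma swap_last: "swap X p q \<Longrightarrow> last p = last q"
  by (induction rule: swap.induct) (auto dest: swap_hd)

lemma edge_path_Cons_Cons [simp]:
  "edge_path X (x # y # p) \<longleftrightarrow> adj X x y \<and> edge_path X (y # p)"
  using adj_in[of X x y] by (auto simp: edge_path_def)

lemma edge_path_singleton [simp]: "edge_path X [x] \<longleftrightarrow> x \<in> \<Union>X"
  by (auto simp: edge_path_def)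

lemma edge_path_Nil [simp]: "\<not> edge_path X []"
  by (simp add: edge_path_def)

lemma swap_edge_path: "swap X p q \<Longrightarrow> edge_path X p \<Longrightarrow> edge_path X q"
proof (induction rule: swap.induct)
  case (swap_here x y z w p)
  then show ?case using sq_adj[OF swap_here(1)] by simp
next
  case (swap_Cons p q x)
  then obtain y p' q' where "p = y # p'" "q = y # q'"
    using swap_hd[OF swap_Cons(1)] by (metis list.collapse)
  then show ?case using swap_Cons by simp
qed

abbreviation swap_eq :: "'a set set \<Rightarrow> 'a list \<Rightarrow> 'a list \<Rightarrow> bool" where
  "swap_eq X \<equiv> (swap X)\<^sup>*\<^sup>*"

lemma swap_eq_sym: "swap_eq X p q \<Longrightarrow> swap_eq X q p"
  by (induction rule: rtranclp_induct) (auto intro: swap_sym converse_rtranclp_into_rtranclp)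

lemma swap_eq_trans: "swap_eq X p q \<Longrightarrow> swap_eq X q r \<Longrightarrow> swap_eq X p r"
  by (rule rtranclp_trans)

lemma swap_eq_Cons: "swap_eq X p q \<Longrightarrow> swap_eq X (x # p) (x # q)"
  by (induction rule: rtranclp_induct) (auto intro: swap_Cons rtranclp.rtrancl_into_rtrancl)

lemma swap_eq_sq: "sq X x y z w \<Longrightarrow> swap_eq X (x # y # z # p) (x # w # z # p)"
  by (rule r_into_rtranclp) (rule swap_here)

lemma swap_eq_length: "swap_eq X p q \<Longrightarrow> length p = length q"
  by (induction rule: rtranclp_induct) (auto dest: swap_length)

lemma swap_eq_hd: "swap_eq X p q \<Longrightarrow> hd p = hd q"
  by (induction rule: rtranclp_induct) (auto dest: swap_hd)

lemma swap_eq_last: "swap_eq X p q \<Longrightarrow> last p = last q"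
  by (induction rule: rtranclp_induct) (auto dest: swap_last)

lemma swap_eq_edge_path: "swap_eq X p q \<Longrightarrow> edge_path X p \<Longrightarrow> edge_path X q"
  by (induction rule: rtranclp_induct) (auto dest: swap_edge_path)

lemma swap_eq_ConsE:
  assumes "swap_eq X (x # p) q"
  obtains q' where "q = x # q'" "length q' = length p"
  using swap_eq_length[OF assms] swap_eq_hd[OF assms] by (cases q) auto

lemma swap_Cons_cases:
  assumes "swap X (x # y # p) (x # z # r)"
  shows "y = z \<and> swap X (y # p) (z # r) \<or> (\<exists>w s. sq X x y w z \<and> p = w # s \<and> r = w # s)"
  using assms
proof (cases rule: swap.cases)
  case (swap_Cons)
  then show ?thesis using swap_hd by force
qed auto

context CAT0
begin

text \<open>
  For a chain of swaps at the front of the path, consecutive squares are merged across a 3-cube;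
  this is the only use of the flag condition.
\<close>

lemma swap_eq_front:
  "swap_eq X (x # y # q) (x # z # r) \<Longrightarrow>
    y = z \<and> swap_eq X (y # q) (y # r) \<or>
    (\<exists>w s. sq X x y w z \<and> swap_eq X (y # q) (y # w # s) \<and> swap_eq X (z # r) (z # w # s))"
proof (induction "length q" arbitrary: x y z q r rule: less_induct)
  case less
  have "\<forall>z r. P = x # z # r \<longrightarrow> y = z \<and> swap_eq X (y # q) (y # r) \<or>
      (\<exists>w s. sq X x y w z \<and> swap_eq X (y # q) (y # w # s) \<and> swap_eq X (z # r) (z # w # s))"
    if "swap_eq X (x # y # q) P" for P
    using that
  proof (induction rule: rtranclp_induct)
    case base
    then show ?case by auto
  next
    case (step P Q)
    show ?case
    proof (intro allI impI)
      fix z r assume Q: "Q = x # z # r"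
      obtain y1 q1 where P: "P = x # y1 # q1" and len: "length q1 = length q"
        using step(1) by (metis (no_types) swap_eq_ConsE length_Suc_conv)
      note IH = step.IH[rule_format, OF P]
      from swap_Cons_cases[OF step.hyps(2)[unfolded P Q]]
      show "y = z \<and> swap_eq X (y # q) (y # r) \<or>
        (\<exists>w s. sq X x y w z \<and> swap_eq X (y # q) (y # w # s) \<and> swap_eq X (z # r) (z # w # s))"
        (is ?goal)
      proof (elim disjE exE conjE)
        assume z: "y1 = z" and s: "swap X (y1 # q1) (z # r)"
        then have s': "swap_eq X (z # q1) (z # r)" by blast
        from IH show ?goal
        proof (elim disjE exE conjE)
          assume "y = y1" "swap_eq X (y # q) (y # q1)"
          then show ?goal using s' z swap_eq_trans by metis
        next
          fix w t assume "sq X x y w y1" "swap_eq X (y # q) (y # w # t)"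
            "swap_eq X (y1 # q1) (y1 # w # t)"
          then show ?goal using s' z swap_eq_trans swap_eq_sym by metis
        qed
      next
        fix w1 s1 assume sq1: "sq X x y1 w1 z" and q1: "q1 = w1 # s1" and r: "r = w1 # s1"
        from IH show ?goal
        proof (elim disjE exE conjE)
          assume "y = y1" "swap_eq X (y # q) (y # q1)"
          then show ?goal using sq1 q1 r by blast
        next
          fix w s assume sq2: "sq X x y w y1" and yq: "swap_eq X (y # q) (y # w # s)"
            and y1: "swap_eq X (y1 # q1) (y1 # w # s)"
          have "length s1 < length q" using q1 len by simp
          \<comment> \<open>Two swap-equivalent paths start at \<open>y1\<close>, one through
            \<open>w1\<close> and one through \<open>w\<close>. Their tails are shorter, so the
            induction hypothesis compares them.\<close>
          from less.hyps[OF this y1[unfolded q1]] show ?goal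
          proof (elim disjE exE conjE)
            assume w: "w1 = w" and s: "swap_eq X (w1 # s1) (w1 # s)"
            have "z = y"
              using sq_unique[OF sq1] sq_unique[OF sq_flip[OF sq2, folded w]] sq1 sq2 w
              by (meson sq_flip sq_unique)
            moreover have "swap_eq X (y # w # s) (y # r)"
              unfolding r using swap_eq_Cons[OF swap_eq_sym[OF s], of y] w by simp
            ultimately show ?goal using yq swap_eq_trans by blast
          next
            fix u t assume sq3: "sq X y1 w1 u w" and w1: "swap_eq X (w1 # s1) (w1 # u # t)"
              and w: "swap_eq X (w # s) (w # u # t)"
            \<comment> \<open>Three squares meet at \<open>y1\<close>, with the neighbours
              \<open>x\<close>, \<open>w1\<close> and \<open>w\<close>. The corner \<open>e\<close>
              opposite to \<open>y1\<close> in their 3-cube completes the square \<open>x\<close>,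
              \<open>y\<close>, \<open>e\<close>, \<open>z\<close>.\<close>
            have a: "sq X y1 x z w1" by (rule sq_swap[OF sq1])
            have b: "sq X y1 x y w" by (rule sq_swap[OF sq_flip[OF sq2]])
            from sq_cube[OF a sq3 b] obtain e
              where e: "sq X z w1 u e" "sq X z x y e" "sq X y w u e" by blast
            have "sq X x y e z"
              using sq_rotate[OF e(2)] by simp
            moreover have "swap_eq X (y # q) (y # e # u # t)"
              by (rule swap_eq_trans[OF yq swap_eq_trans[OF swap_eq_Cons[OF w] swap_eq_sq[OF e(3)]]])
            moreover have "swap_eq X (z # r) (z # e # u # t)"
              unfolding r
              by (rule swap_eq_trans[OF swap_eq_Cons[OF w1] swap_eq_sq[OF e(1)]])
            ultimately show ?goal by blast
          qed
        qed
      qed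
    qed
  qed
  then show ?case using less.prems by blast
qed

text \<open>The square alternative of \<open>swap_eq_front\<close> would make two distinct corners
  equal to \<open>y\<close>.\<close>

lemma swap_eq_cancel:
  assumes "swap_eq X (x # y # q) (x # y # r)"
  shows "swap_eq X (y # q) (y # r)"
  using swap_eq_front[OF assms] by (elim disjE exE conjE) (auto dest: sq_distinct)

text \<open>A backtrack may become visible only after some swaps, hence the test on the whole swap
  class.\<close>

definition reduced :: "'a list \<Rightarrow> bool" where
  "reduced p \<longleftrightarrow> (\<forall>q. swap_eq X p q \<longrightarrow> \<not> backtracks q)"

lemma reducedI: "(\<And>q. swap_eq X p q \<Longrightarrow> \<not> backtracks q) \<Longrightarrow> reduced p"
  by (simp add: reduced_def)

lemma reducedD: "reduced p \<Longrightarrow> swap_eq X p q \<Longrightarrow> \<not> backtracks q"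
  by (simp add: reduced_def)

lemma reduced_swap_eq: "reduced p \<Longrightarrow> swap_eq X p q \<Longrightarrow> reduced q"
  by (rule reducedI) (rule reducedD, assumption, rule swap_eq_trans)

lemma reduced_tl: "reduced (x # p) \<Longrightarrow> reduced p"
  by (rule reducedI) (metis reducedD swap_eq_Cons backtracks_Cons)

lemma not_reduced_backtrack: "\<not> reduced (x # y # x # p)"
  using reducedD[OF _ rtranclp.rtrancl_refl] backtracks_here by metis

text \<open>Take a path with a backtrack that is swap-equivalent to \<open>y # x # p\<close>. A
  backtrack behind the front is carried across the square of \<open>swap_eq_front\<close> to a
  shorter path and handled by induction. One at the front gives the claim at once, unless a square
  intervenes, and then \<open>x # p\<close> itself would not be reduced.\<close>

lemma reduced_Cons_or_descent:
  "reduced (x # p) \<Longrightarrow> \<not> reduced (y # x # p) \<Longrightarrow> \<exists>q. swap_eq X (x # p) (x # y # q)"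
proof (induction "length p" arbitrary: p x y rule: less_induct)
  case less
  obtain P where P: "swap_eq X (y # x # p) P" "backtracks P"
    using less.prems(2) reducedI by metis
  obtain x' P2 where P_eq: "P = y # x' # P2" and len: "length P2 = length p"
    using P(1) by (metis (no_types) swap_eq_ConsE length_Suc_conv)
  have no_bt: "\<not> (x = x' \<and> swap_eq X (x # p) (x # P2) \<and> backtracks (x' # P2))"
    using reducedD[OF less.prems(1)] by metis
  consider (inner) "backtracks (x' # P2)" | (outer) P3 where "P2 = y # P3"
    using P(2) unfolding P_eq backtracks_Cons_iff[of y] by auto
  then show ?case
  proof cases
    case inner
    with swap_eq_front[OF P(1)[unfolded P_eq]] no_bt
    obtain w s where w: "sq X y x w x'" "swap_eq X (x # p) (x # w # s)"
        "swap_eq X (x' # P2) (x' # w # s)"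
      by blast
    have "reduced (w # s)" using reduced_tl[OF reduced_swap_eq[OF less.prems(1) w(2)]] .
    moreover have "\<not> reduced (x' # w # s)"
      using reducedD[OF _ swap_eq_sym[OF w(3)]] inner by blast
    moreover have "length s < length p" using swap_eq_length[OF w(2)] by simp
    ultimately obtain q where q: "swap_eq X (w # s) (w # x' # q)" using less.hyps by blast
    have "sq X x w x' y" using sq_rotate[OF w(1)] .
    then have "swap_eq X (x # p) (x # y # x' # q)"
      using swap_eq_trans[OF w(2) swap_eq_trans[OF swap_eq_Cons[OF q] swap_eq_sq]] by blast
    then show ?thesis by blast
  next
    case outer
    from swap_eq_front[OF P(1)[unfolded P_eq outer]] show ?thesis
    proof (elim disjE exE conjE)
      assume "x = x'" "swap_eq X (x # p) (x # y # P3)"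
      then show ?thesis by blast
    next
      fix w s assume w: "sq X y x w x'" "swap_eq X (x # p) (x # w # s)"
        "swap_eq X (x' # y # P3) (x' # w # s)"
      from w(1) have "y \<noteq> w" by (auto simp: sq_def)
      with swap_eq_front[OF w(3)] obtain u t where u: "sq X x' y u w"
          "swap_eq X (w # s) (w # u # t)" by blast
      have "sq X x' y x w" using sq_flip[OF sq_rotate[OF sq_rotate[OF sq_rotate[OF w(1)]]]]
          sq_rotate[OF sq_rotate[OF sq_rotate[OF w(1)]]] by blast
      \<comment> \<open>Both squares have the corners \<open>y\<close>, \<open>x'\<close>,
        \<open>w\<close>, hence the same fourth corner. So \<open>x # p\<close> could be swapped to
        a path that backtracks along \<open>x\<close>, \<open>w\<close>, \<open>x\<close>.\<close>
      then have "u = x" using sq_unique'[OF u(1)] by blast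
      then have "swap_eq X (x # p) (x # w # x # t)"
        using swap_eq_trans[OF w(2) swap_eq_Cons[OF u(2)]] by blast
      then show ?thesis
        using less.prems(1) not_reduced_backtrack reduced_swap_eq by blast
    qed
  qed
qed

end


section \<open>Normal forms of paths\<close>

lemma elementary_homotopy_sq:
  "{x, y, z, w} \<in> X \<Longrightarrow> distinct [x, y, z, w] \<Longrightarrow>
     adj X x y \<Longrightarrow> adj X y z \<Longrightarrow> adj X z w \<Longrightarrow> adj X w x \<Longrightarrow> sq X x y z w"
  by (simp add: sq_def)

lemma backtracks_shorten:
  "backtracks p \<Longrightarrow> edge_path X p \<Longrightarrow>
    \<exists>q. edge_path X q \<and> hd q = hd p \<and> last q = last p \<and> length p = length q + 2"
proof (induction rule: backtracks.induct)
  case (backtracks_here x y p)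
  then show ?case
    by (intro exI[of _ "x # p"]) auto
next
  case (backtracks_Cons p x)
  obtain y p' where p: "p = y # p'" using backtracks_Cons(1) by (cases p) auto
  with backtracks_Cons obtain q where q: "edge_path X q" "hd q = y" "last q = last p"
    "length p = length q + 2" by auto
  then obtain q' where "q = y # q'" by (cases q) auto
  then show ?case using q p backtracks_Cons(3)
    by (intro exI[of _ "x # q"]) auto
qed

context CAT0
begin

text \<open>
  Up to swaps, this is an action of the edge from \<open>hd R\<close> to \<open>y\<close> on the reduced paths: paths are
  extended at the head, and by \<open>swap_eq_cancel\<close> the choice is irrelevant.
\<close>

definition step :: "'a \<Rightarrow> 'a list \<Rightarrow> 'a list" where
  "step y R = (if \<exists>q. swap_eq X R (hd R # y # q)
     then y # (SOME q. swap_eq X R (hd R # y # q)) else y # R)"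

lemma step_descent:
  assumes "swap_eq X R (x # y # q)"
  shows "swap_eq X (step y R) (y # q)"
proof -
  let ?q = "SOME q. swap_eq X R (hd R # y # q)"
  have hd: "hd R = x" using swap_eq_hd[OF assms] by simp
  then have "swap_eq X R (x # y # ?q)" using someI[of "\<lambda>q. swap_eq X R (hd R # y # q)"] assms by simp
  then have "swap_eq X (x # y # ?q) (x # y # q)"
    using assms swap_eq_sym swap_eq_trans by blast
  then have "swap_eq X (y # ?q) (y # q)" by (rule swap_eq_cancel)
  moreover have "step y R = y # ?q" using assms hd unfolding step_def by auto
  ultimately show ?thesis by simp
qed

lemma step_ascent: "\<nexists>q. swap_eq X (x # r) (x # y # q) \<Longrightarrow> step y (x # r) = y # x # r"
  by (simp add: step_def)

lemma step_swap_eq: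
  assumes "swap_eq X R R'" "R \<noteq> []"
  shows "swap_eq X (step y R) (step y R')"
proof -
  obtain x r where R: "R = x # r" using assms(2) by (cases R) auto
  then obtain r' where R': "R' = x # r'" using swap_eq_ConsE assms(1) by metis
  show ?thesis
  proof (cases "\<exists>q. swap_eq X R (x # y # q)")
    case True
    then obtain q where q: "swap_eq X R (x # y # q)" by blast
    then have "swap_eq X R' (x # y # q)" using assms(1) swap_eq_sym swap_eq_trans by blast
    from step_descent[OF this] step_descent[OF q] show ?thesis
      using swap_eq_sym swap_eq_trans by blast
  next
    case False
    then have "\<nexists>q. swap_eq X R' (x # y # q)" using assms(1) swap_eq_trans by blast
    then have "step y R' = y # R'" "step y R = y # R"
      using False step_ascent unfolding R R' by auto
    then show ?thesis using assms(1) swap_eq_Cons by simp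
  qed
qed

lemma step_reduced:
  assumes "reduced (x # r)"
  shows "reduced (step y (x # r))"
proof (cases "\<exists>q. swap_eq X (x # r) (x # y # q)")
  case True
  then obtain q where q: "swap_eq X (x # r) (x # y # q)" by blast
  then have "reduced (y # q)" using assms reduced_swap_eq reduced_tl by blast
  then show ?thesis using reduced_swap_eq swap_eq_sym step_descent[OF q] by blast
next
  case False
  then show ?thesis using step_ascent[OF False] reduced_Cons_or_descent[OF assms] by auto
qed

lemma step_Cons: "\<exists>r'. step y (x # r) = y # r'"
  by (auto simp: step_def)

lemma step_cases:
  obtains (descent) q where "swap_eq X (x # r) (x # y # q)" "swap_eq X (step y (x # r)) (y # q)"
  | (ascent) "\<nexists>q. swap_eq X (x # r) (x # y # q)" "step y (x # r) = y # x # r"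
  using step_descent step_ascent by blast

lemma step_length:
  "length (step y (x # r)) = length (x # r) + 1 \<or> length (x # r) = length (step y (x # r)) + 1"
  by (cases rule: step_cases[of x r y]) (auto dest!: swap_eq_length)

text \<open>If the first step removes an edge, reducedness prevents the second from removing
  another, so it puts the edge back. If the first step adds an edge, the second removes it.\<close>

lemma step_backtrack:
  assumes "reduced (x # r)"
  shows "swap_eq X (step x (step y (x # r))) (x # r)"
proof (cases rule: step_cases[of x r y])
  case (descent q)
  have "\<nexists>t. swap_eq X (y # q) (y # x # t)"
  proof
    assume "\<exists>t. swap_eq X (y # q) (y # x # t)"
    then obtain t where "swap_eq X (y # q) (y # x # t)" by blast
    from swap_eq_trans[OF descent(1) swap_eq_Cons[OF this]]
    have "reduced (x # y # x # t)" by (rule reduced_swap_eq[OF assms])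
    then show False by (simp only: not_reduced_backtrack)
  qed
  then have "step x (y # q) = x # y # q" by (rule step_ascent)
  moreover have "step y (x # r) \<noteq> []" using step_Cons[of y x r] by auto
  ultimately have "swap_eq X (step x (step y (x # r))) (x # y # q)"
    using step_swap_eq[OF descent(2), of x] by simp
  then show ?thesis using swap_eq_sym[OF descent(1)] by (rule swap_eq_trans)
next
  case ascent
  then show ?thesis using step_descent[of "y # x # r" y x r] by simp
qed

text \<open>This makes the action of edges invariant under pushing across a square. The cases are
  whether the steps from \<open>x\<close> to \<open>y\<close> and to \<open>w\<close> shorten the
  path.\<close>

lemma step_sq:
  assumes sq: "sq X x y z w" and red: "reduced (x # r)"
  shows "swap_eq X (step z (step y (x # r))) (step z (step w (x # r)))"
proof -
  have ne: "step y R \<noteq> []" for y R by (simp add: step_def)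
  \<comment> \<open>Only the step to \<open>y\<close> shortens. If the next one to \<open>z\<close>
    did so too, swapping across the square would let the step to \<open>w\<close> shorten as
    well.\<close>
  have mixed: "swap_eq X (step z (step y (x # r))) (step z (step w (x # r)))"
    if sq: "sq X x y z w" and y: "swap_eq X (x # r) (x # y # q)"
      and w: "\<nexists>q. swap_eq X (x # r) (x # w # q)" for y w q
  proof -
    have "\<nexists>t. swap_eq X (y # q) (y # z # t)"
    proof
      assume "\<exists>t. swap_eq X (y # q) (y # z # t)"
      then obtain t where "swap_eq X (y # q) (y # z # t)" by blast
      from swap_eq_trans[OF y swap_eq_trans[OF swap_eq_Cons[OF this] swap_eq_sq[OF sq]]]
      show False using w by blast
    qed
    then have "step z (y # q) = z # y # q" by (rule step_ascent)
    then have l: "swap_eq X (step z (step y (x # r))) (z # y # q)"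
      using step_swap_eq[OF step_descent[OF y] ne, of z] by simp
    have "swap_eq X (w # x # r) (w # z # y # q)"
      using swap_eq_Cons[OF y] swap_eq_sq[OF sq_rotate[OF sq_rotate[OF sq_rotate[OF sq]]]]
      by (rule swap_eq_trans)
    then have "swap_eq X (step z (w # x # r)) (z # y # q)"
      by (rule step_descent)
    from swap_eq_trans[OF l swap_eq_sym[OF this]] show ?thesis
      unfolding step_ascent[OF w] .
  qed
  \<comment> \<open>After adding the edge to \<open>y\<close>, a shortening step to \<open>z\<close>
    would produce a square whose fourth corner must be \<open>w\<close>, so the step to
    \<open>w\<close> would shorten.\<close>
  have up: "step z (y # x # r) = z # y # x # r"
    if sq: "sq X x y z w" and w: "\<nexists>q. swap_eq X (x # r) (x # w # q)" for y w
  proof (rule step_ascent, rule notI)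
    assume "\<exists>t. swap_eq X (y # x # r) (y # z # t)"
    then obtain t where "swap_eq X (y # x # r) (y # z # t)" by blast
    from swap_eq_front[OF this] sq_distinct[OF sq]
    obtain u s where u: "sq X y x u z" "swap_eq X (x # r) (x # u # s)" by auto
    have "sq X y x w z" by (rule sq_swap[OF sq])
    then have "u = w" using sq_unique'[OF u(1)] by simp
    then show False using u(2) w by blast
  qed
  show ?thesis
  proof (cases "\<exists>q. swap_eq X (x # r) (x # y # q)"; cases "\<exists>q. swap_eq X (x # r) (x # w # q)")
    assume "\<exists>q. swap_eq X (x # r) (x # y # q)" "\<exists>q. swap_eq X (x # r) (x # w # q)"
    then obtain q q' where q: "swap_eq X (x # r) (x # y # q)" "swap_eq X (x # r) (x # w # q')"
      by blast
    \<comment> \<open>Both steps shorten. The square found at the front is the given one, so both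
      paths go on through \<open>z\<close>.\<close>
    from swap_eq_front[OF swap_eq_trans[OF swap_eq_sym[OF q(1)] q(2)]] sq_distinct[OF sq]
    obtain u s where u: "sq X x y u w" "swap_eq X (y # q) (y # u # s)" "swap_eq X (w # q') (w # u # s)"
      by auto
    have "u = z" using sq_unique'[OF u(1) sq] .
    have "swap_eq X (step z (step y (x # r))) (z # s)"
      using swap_eq_trans[OF step_descent[OF q(1)] u(2)] unfolding \<open>u = z\<close> by (rule step_descent)
    moreover have "swap_eq X (step z (step w (x # r))) (z # s)"
      using swap_eq_trans[OF step_descent[OF q(2)] u(3)] unfolding \<open>u = z\<close> by (rule step_descent)
    ultimately show ?thesis by (rule swap_eq_trans[OF _ swap_eq_sym])
  next
    assume "\<exists>q. swap_eq X (x # r) (x # y # q)" "\<nexists>q. swap_eq X (x # r) (x # w # q)"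
    then show ?thesis using mixed[OF sq] by blast
  next
    assume "\<nexists>q. swap_eq X (x # r) (x # y # q)" "\<exists>q. swap_eq X (x # r) (x # w # q)"
    then show ?thesis using swap_eq_sym[OF mixed[OF sq_flip[OF sq]]] by blast
  next
    assume y: "\<nexists>q. swap_eq X (x # r) (x # y # q)" and w: "\<nexists>q. swap_eq X (x # r) (x # w # q)"
    have "sq X z y x w" by (rule sq_flip[OF sq_rotate[OF sq_rotate[OF sq]]])
    then show ?thesis
      unfolding step_ascent[OF y] step_ascent[OF w] up[OF sq w] up[OF sq_flip[OF sq] y]
      by (rule swap_eq_sq)
  qed
qed

text \<open>The edges act by \<open>step\<close> one after another, starting from the trivial path
  at the last vertex.\<close>

fun nf :: "'a list \<Rightarrow> 'a list" where
  "nf [] = []"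
| "nf [x] = [x]"
| "nf (y # x # p) = step y (nf (x # p))"

lemma nf_Cons: "p \<noteq> [] \<Longrightarrow> nf (y # p) = step y (nf p)"
  by (cases p) auto

lemma nf_Cons_eq: "\<exists>r. nf (x # p) = x # r"
  by (cases p) (auto simp: step_def)

lemma nf_reduced: "reduced (nf p)"
proof (induction p rule: nf.induct)
  case 1
  show ?case by (rule reducedI) (auto dest!: swap_eq_length elim: backtracks.cases)
next
  case (2 x)
  show ?case by (rule reducedI) (auto dest!: swap_eq_length elim: backtracks.cases)
next
  case (3 y x p)
  obtain r where "nf (x # p) = x # r" using nf_Cons_eq by blast
  then show ?case using 3 step_reduced by simp
qed

text \<open>Each step changes the length by exactly one. The parity clause is what later makes the
  1-skeleton bipartite.\<close>

lemma nf_length: "length (nf p) \<le> length p \<and> even (length p + length (nf p))"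
proof (induction p rule: nf.induct)
  case (3 y x p)
  obtain r where "nf (x # p) = x # r" using nf_Cons_eq by blast
  then show ?case using 3 step_length[of y x r] by auto
qed auto

text \<open>A shortening step would exhibit a backtrack in a path swap-equivalent to the given one,
  so every step just adds its edge.\<close>

lemma nf_of_reduced: "reduced p \<Longrightarrow> nf p = p"
proof (induction p rule: nf.induct)
  case (3 y x p)
  have "\<nexists>q. swap_eq X (x # p) (x # y # q)"
    using reduced_swap_eq[OF 3(2) swap_eq_Cons] not_reduced_backtrack by metis
  then show ?case using 3(1)[OF reduced_tl[OF 3(2)]] step_ascent by simp
qed auto

lemma nf_append_cong:
  assumes "swap_eq X (nf (x # p)) (nf (x # q))"
  shows "swap_eq X (nf (us @ x # p)) (nf (us @ x # q))"
proof (induction us)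
  case (Cons a us)
  obtain b r where "us @ x # p = b # r" by (cases us) auto
  then have "nf (us @ x # p) \<noteq> []" using nf_Cons_eq[of b r] by auto
  then show ?case using step_swap_eq[OF Cons] by (simp add: nf_Cons)
qed (use assms in simp)

lemma nf_backtrack: "swap_eq X (nf (us @ x # y # x # p)) (nf (us @ x # p))"
proof -
  obtain r where r: "nf (x # p) = x # r" using nf_Cons_eq by blast
  have "swap_eq X (nf (x # y # x # p)) (nf (x # p))"
    using step_backtrack[of x r y] nf_reduced[of "x # p"] unfolding r by (simp add: r)
  then show ?thesis by (rule nf_append_cong)
qed

lemma nf_elementary_homotopy: "elementary_homotopy X p q \<Longrightarrow> swap_eq X (nf p) (nf q)"
proof (induction rule: elementary_homotopy.induct)
  case (backtrack x y us vs)
  then show ?case using swap_eq_sym[OF nf_backtrack] by simp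
next
  case (square x y z w us vs)
  then have sq: "sq X x y z w" by (intro elementary_homotopy_sq) auto
  obtain r where r: "nf (z # vs) = z # r" using nf_Cons_eq by blast
  have "sq X z y x w" by (rule sq_flip[OF sq_rotate[OF sq_rotate[OF sq]]])
  then have "swap_eq X (nf (x # y # z # vs)) (nf (x # w # z # vs))"
    using step_sq nf_reduced[of "z # vs"] by (simp add: r)
  from nf_append_cong[OF this] show ?case by simp
qed

lemma nf_homotopic: "equivclp (elementary_homotopy X) p q \<Longrightarrow> swap_eq X (nf p) (nf q)"
proof (induction rule: equivclp_induct)
  case (step y z)
  have "swap_eq X (nf y) (nf z)"
    using step(2) nf_elementary_homotopy[of y z] swap_eq_sym[OF nf_elementary_homotopy[of z y]] by blast
  then show ?case by (rule swap_eq_trans[OF step(3)])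
qed simp

text \<open>The backtracks cancel one by one, from the turning point \<open>b\<close>
  outwards.\<close>

lemma nf_retrace: "swap_eq X (nf (p @ b # rev p @ c)) (nf (hd (p @ [b]) # c))"
proof (induction p arbitrary: b rule: rev_induct)
  case (snoc z p)
  have "swap_eq X (nf (p @ z # b # z # rev p @ c)) (nf (p @ z # rev p @ c))"
    by (rule nf_backtrack)
  then have "swap_eq X (nf (p @ z # b # z # rev p @ c)) (nf (hd (p @ [z]) # c))"
    using snoc by (rule swap_eq_trans)
  then show ?case by (cases p) auto
qed simp

lemma edge_path_append:
  assumes "edge_path X p" "edge_path X q" "last p = hd q"
  shows "edge_path X (p @ tl q)" "hd (p @ tl q) = hd p" "last (p @ tl q) = last q"
proof -
  obtain y q' where q: "q = y # q'" using assms(2) by (cases q) auto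
  show "edge_path X (p @ tl q)"
  proof (cases q')
    case (Cons z q'')
    then have "adj X (last p) z" "successively (adj X) q'" "set q' \<subseteq> \<Union>X"
      using assms(2,3) unfolding q edge_path_def by simp_all
    then show ?thesis
      using assms(1) Cons unfolding q edge_path_def by (simp add: successively_append_iff)
  qed (use assms(1) q in simp)
  show "hd (p @ tl q) = hd p" "last (p @ tl q) = last q"
    using assms unfolding q edge_path_def by auto
qed

lemma edge_path_rev: "edge_path X p \<Longrightarrow> edge_path X (rev p)"
  unfolding edge_path_def successively_rev set_rev rev_is_Nil_conv
  by (elim conjE, intro conjI, assumption, assumption, erule successively_mono, erule adj_sym)

text \<open>Simple connectedness enters here: the loop that runs back along \<open>p\<close> and
  then along \<open>q\<close> has the normal form of a constant path. Put \<open>p\<close> without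
  its last vertex in front of it; cancelling the loop leaves \<open>p\<close>, while cancelling the
  retraced \<open>p\<close> leaves \<open>q\<close>.\<close>

lemma nf_same_ends:
  assumes p: "edge_path X p" and q: "edge_path X q" and ends: "hd p = hd q" "last p = last q"
  shows "swap_eq X (nf p) (nf q)"
proof -
  obtain p0 b where p0: "p = p0 @ [b]" using p by (cases p rule: rev_cases) auto
  obtain x q' where q': "q = x # q'" using q by (cases q) auto
  let ?L = "rev p @ tl q"
  have L: "?L = b # rev p0 @ q'" using p0 q' by simp
  have "last (rev p) = hd q" using ends(1) p by (simp add: last_rev edge_path_def)
  note L' = edge_path_append[OF edge_path_rev[OF p] q this]
  then have "hd ?L = last ?L" using ends(2) by (simp only: hd_rev)
  then have "equivclp (elementary_homotopy X) ?L [hd ?L]"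
    using CAT0 L'(1) unfolding CAT0_cube_complex_def simply_connected_complex_def by metis
  then have "swap_eq X (nf (b # rev p0 @ q')) (nf [b])"
    using nf_homotopic unfolding L by (metis list.sel(1))
  then have "swap_eq X (nf (p0 @ b # rev p0 @ q')) (nf p)"
    unfolding p0 by (rule nf_append_cong)
  moreover have "hd (p0 @ [b]) # q' = q" using ends(1) p0 q' by simp
  then have "swap_eq X (nf (p0 @ b # rev p0 @ q')) (nf q)"
    using nf_retrace[of p0 b q'] by simp
  ultimately show ?thesis by (rule swap_eq_trans[OF swap_eq_sym])
qed

end


section \<open>The combinatorial distance\<close>

context CAT0
begin

abbreviation V :: "'a set" where "V \<equiv> \<Union>X"

lemma d_path:
  assumes "x \<in> V" "y \<in> V"
  obtains p where "edge_path X p" "hd p = x" "last p = y" "length p = Suc (d x y)"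
proof -
  obtain p where p: "edge_path X p" "hd p = x" "last p = y"
    using CAT0 assms unfolding CAT0_cube_complex_def simply_connected_complex_def by metis
  then have "length p = Suc (length p - 1)" by (cases p) auto
  then have "\<exists>n p. edge_path X p \<and> hd p = x \<and> last p = y \<and> length p = Suc n" using p by metis
  from LeastI_ex[OF this] show thesis using that unfolding cdist_def by blast
qed

lemma d_le: "edge_path X p \<Longrightarrow> hd p = x \<Longrightarrow> last p = y \<Longrightarrow> length p \<le> Suc n \<Longrightarrow> d x y \<le> n"
proof -
  assume p: "edge_path X p" "hd p = x" "last p = y" "length p \<le> Suc n"
  then have "length p = Suc (length p - 1)" by (cases p) auto
  then have "d x y \<le> length p - 1" unfolding cdist_def using p by (intro Least_le) metis
  then show ?thesis using p(4) by simp
qed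

lemma d_self: "x \<in> V \<Longrightarrow> d x x = 0"
  using d_le[of "[x]" x x 0] by simp

lemma d_eq_0:
  assumes "x \<in> V" "y \<in> V" "d x y = 0"
  shows "x = y"
proof -
  obtain p where p: "edge_path X p" "hd p = x" "last p = y" "length p = Suc (d x y)"
    using d_path assms(1,2) by blast
  then have "length p = 1" using assms(3) by simp
  then show ?thesis using p by (cases p) auto
qed

lemma d_sym:
  assumes "x \<in> V" "y \<in> V"
  shows "d x y = d y x"
proof -
  have "d x y \<le> d y x" if xy: "x \<in> V" "y \<in> V" for x y
  proof -
    obtain p where p: "edge_path X p" "hd p = y" "last p = x" "length p = Suc (d y x)"
      using d_path xy by blast
    then show ?thesis using d_le[OF edge_path_rev[OF p(1)]] by (simp add: hd_rev last_rev)
  qed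
  then show ?thesis using assms by (simp add: le_antisym)
qed

lemma d_triangle:
  assumes "x \<in> V" "y \<in> V" "z \<in> V"
  shows "d x z \<le> d x y + d y z"
proof -
  obtain p where p: "edge_path X p" "hd p = x" "last p = y" "length p = Suc (d x y)"
    using d_path assms by blast
  obtain q where q: "edge_path X q" "hd q = y" "last q = z" "length q = Suc (d y z)"
    using d_path assms by blast
  have "last p = hd q" using p q by simp
  from edge_path_append[OF p(1) q(1) this] show ?thesis
    using p q by (intro d_le[of "p @ tl q"]) auto
qed

lemma d_adj:
  assumes "adj X x y"
  shows "d x y = 1"
proof -
  have V: "x \<in> V" "y \<in> V" using adj_in assms by fast+
  have "d x y \<le> 1" using assms V by (intro d_le[of "[x, y]"]) auto
  moreover have "d x y \<noteq> 0" using d_eq_0[OF V] assms by (auto simp: adj_def)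
  ultimately show ?thesis by simp
qed

definition geodesic :: "'a list \<Rightarrow> bool" where
  "geodesic p \<longleftrightarrow> edge_path X p \<and> length p = Suc (d (hd p) (last p))"

lemma geodesic_reduced:
  assumes "geodesic p"
  shows "reduced p"
proof (rule reducedI, rule notI)
  fix q assume q: "swap_eq X p q" "backtracks q"
  have "edge_path X q" using assms swap_eq_edge_path[OF q(1)] by (simp add: geodesic_def)
  then obtain r where "edge_path X r" "hd r = hd q" "last r = last q" "length q = length r + 2"
    using backtracks_shorten[OF q(2)] by metis
  then have "Suc (d (hd p) (last p)) \<le> length p - 1"
    using d_le[of r "hd p" "last p" "length p - 3"] swap_eq_hd[OF q(1)] swap_eq_last[OF q(1)]
      swap_eq_length[OF q(1)] by (cases r) auto
  then show False using assms by (simp add: geodesic_def)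
qed

text \<open>Geodesics are reduced, hence equal to their normal forms, and these depend on the ends
  only.\<close>

lemma geodesic_unique:
  assumes "geodesic p" "geodesic q" "hd p = hd q" "last p = last q"
  shows "swap_eq X p q"
  using nf_same_ends[of p q] assms nf_of_reduced geodesic_reduced
  by (simp add: geodesic_def)

lemma even_length_diff:
  assumes "edge_path X p" "edge_path X q" "hd p = hd q" "last p = last q"
  shows "even (length p + length q)"
  using nf_length[of p] nf_length[of q] swap_eq_length[OF nf_same_ends[OF assms]] by presburger

text \<open>Equal distances are excluded by parity: the edge from \<open>y\<close> to
  \<open>x\<close> followed by a geodesic to \<open>b\<close> would be one edge longer than a
  geodesic from \<open>y\<close> to \<open>b\<close>.\<close>

lemma d_adj_cases:
  assumes "adj X x y" "b \<in> V"
  shows "d y b = Suc (d x b) \<or> d x b = Suc (d y b)"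
proof -
  have V: "x \<in> V" "y \<in> V" using adj_in assms by fast+
  have "d y b \<le> Suc (d x b)" "d x b \<le> Suc (d y b)"
    using d_triangle[of y x b] d_triangle[of x y b] d_adj[OF assms(1)] d_adj[OF adj_sym[OF assms(1)]]
      V assms(2) by simp_all
  moreover have "d x b \<noteq> d y b"
  proof
    assume eq: "d x b = d y b"
    obtain p where p: "edge_path X p" "hd p = x" "last p = b" "length p = Suc (d x b)"
      using d_path V assms by blast
    obtain q where q: "edge_path X q" "hd q = y" "last q = b" "length q = Suc (d y b)"
      using d_path V assms by blast
    obtain p' where "p = x # p'" using p by (cases p) auto
    then have "edge_path X (y # p)" "last (y # p) = b" using p assms(1) by (simp_all add: adj_sym)
    from even_length_diff[OF this(1) q(1)] this(2) show False using p q eq by simp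
  qed
  ultimately show ?thesis by linarith
qed

lemma geodesic_Cons:
  assumes "adj X x y" "b \<in> V" "d x b = Suc (d y b)"
  obtains p where "geodesic (x # y # p)" "last (y # p) = b" "length p = d y b"
proof -
  have V: "x \<in> V" "y \<in> V" using adj_in assms by fast+
  obtain q where q: "edge_path X q" "hd q = y" "last q = b" "length q = Suc (d y b)"
    using d_path V assms by blast
  obtain p where p: "q = y # p" using q by (cases q) auto
  show thesis using that[of p] q p assms by (simp add: geodesic_def)
qed

lemma descend:
  assumes "x \<in> V" "b \<in> V" "d x b = Suc k"
  shows "\<exists>y. adj X x y \<and> d y b = k"
proof -
  obtain p where p: "edge_path X p" "hd p = x" "last p = b" "length p = Suc (Suc k)"
    using d_path[OF assms(1,2)] assms(3) by metis
  then obtain y q where q: "p = x # y # q" by (cases p; cases "tl p") auto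
  then have y: "adj X x y" "edge_path X (y # q)" using p by auto
  have "d y b \<le> k" using d_le[OF y(2)] p q by simp
  then show ?thesis using d_adj_cases[OF y(1) assms(2)] assms(3) y(1) by auto
qed

lemma quadrangle:
  assumes "adj X x y" "adj X x z" "y \<noteq> z" "b \<in> V" "d x b = Suc (d y b)" "d x b = Suc (d z b)"
  shows "\<exists>w. sq X x y w z \<and> d y b = Suc (d w b)"
proof -
  obtain p where p: "geodesic (x # y # p)" "last (y # p) = b" "length p = d y b"
    using geodesic_Cons assms by metis
  obtain q where q: "geodesic (x # z # q)" "last (z # q) = b"
    using geodesic_Cons assms by metis
  have "swap_eq X (x # y # p) (x # z # q)"
    using p q by (intro geodesic_unique) auto
  from swap_eq_front[OF this] assms(3) obtain w s
    where w: "sq X x y w z" "swap_eq X (y # p) (y # w # s)" by blast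
  have "edge_path X (y # p)" using p(1) by (simp add: geodesic_def)
  then have "edge_path X (w # s)" using swap_eq_edge_path[OF w(2)] by simp
  moreover have "last (w # s) = b" using swap_eq_last[OF w(2)] p(2) by simp
  moreover have len: "length p = Suc (length s)" using swap_eq_length[OF w(2)] by simp
  ultimately have "d w b \<le> length s" by (intro d_le) auto
  then have "Suc (d w b) \<le> d y b" using len p(3) by simp
  then show ?thesis using d_adj_cases[OF sq_adj(2)[OF w(1)] assms(4)] w(1) by fastforce
qed

end


section \<open>Half-spaces\<close>

context CAT0
begin

text \<open>For an edge this is the half-space on the side of \<open>x\<close> of the dual
  hyperplane, as \<open>sides_eq\<close> shows.\<close>

definition nearer :: "'a \<Rightarrow> 'a \<Rightarrow> 'a set" where
  "nearer x y = {v \<in> V. d v x < d v y}"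

lemma d_adj_cases':
  assumes "adj X x y" "v \<in> V"
  shows "d v y = Suc (d v x) \<or> d v x = Suc (d v y)"
  using d_adj_cases[OF assms]
  unfolding d_sym[OF adj_in(1)[OF assms(1)] assms(2)] d_sym[OF adj_in(2)[OF assms(1)] assms(2)] .

lemma nearer_iff:
  assumes "adj X x y" "v \<in> V"
  shows "v \<in> nearer x y \<longleftrightarrow> d v y = Suc (d v x)"
  using d_adj_cases'[OF assms] assms(2) by (auto simp: nearer_def)

lemma nearer_subset: "nearer x y \<subseteq> V"
  by (auto simp: nearer_def)

lemma nearer_compl:
  assumes "adj X x y"
  shows "nearer y x = V - nearer x y"
proof -
  have "v \<in> nearer y x \<longleftrightarrow> v \<notin> nearer x y" if "v \<in> V" for v
    using d_adj_cases'[OF assms that] that by (auto simp: nearer_def)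
  then show ?thesis using nearer_subset by blast
qed

lemma nearer_ends:
  assumes "adj X x y"
  shows "x \<in> nearer x y" "y \<notin> nearer x y"
proof -
  have V: "x \<in> V" "y \<in> V" using adj_in[OF assms] .
  have "d x y = 1" "d x x = 0" "d y y = 0" using d_adj[OF assms] V by (simp_all only: d_self)
  then show "x \<in> nearer x y" "y \<notin> nearer x y" using V by (simp_all add: nearer_def)
qed

text \<open>Suppose \<open>v\<close> is nearer to \<open>x\<close> than to \<open>y\<close>, but
  nearer to \<open>z\<close> than to \<open>w\<close>. Then \<open>x\<close> and \<open>z\<close>
  are neighbours of \<open>y\<close> closer to \<open>v\<close>, and the quadrangle condition gives
  a fourth corner closer still. By uniqueness this corner is \<open>w\<close>, which is too far
  away.\<close>

lemma nearer_sq: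
  assumes "sq X x y z w"
  shows "nearer x y = nearer w z"
proof -
  have sub: "nearer x y \<subseteq> nearer w z" if sq: "sq X x y z w" for x y z w
  proof
    fix v assume v: "v \<in> nearer x y"
    then have vV: "v \<in> V" using nearer_subset by blast
    note a = sq_adj[OF sq]
    have V: "x \<in> V" "y \<in> V" "z \<in> V" "w \<in> V"
      using adj_in[OF a(1)] adj_in[OF a(3)] by auto
    have s: "d v x = d x v" "d v y = d y v" "d v z = d z v" "d v w = d w v"
      using d_sym[OF vV] V by blast+
    have xy: "d y v = Suc (d x v)" using v nearer_iff[OF a(1) vV] unfolding s by simp
    show "v \<in> nearer w z"
    proof (rule ccontr)
      assume "v \<notin> nearer w z"
      then have wz: "d w v = Suc (d z v)"
        using nearer_compl[OF a(7)] nearer_iff[OF a(3) vV] vV unfolding s by blast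
      then have eq: "d z v = d x v"
        using d_adj_cases[OF a(2) vV] d_adj_cases[OF a(4) vV] xy by linarith
      have "x \<noteq> z" using sq_distinct[OF sq] by simp
      from quadrangle[OF a(5) a(2) this vV xy] eq xy obtain u
        where u: "sq X y x u z" "d x v = Suc (d u v)" by auto
      have "u = w" using sq_unique'[OF u(1) sq_swap[OF sq]] .
      then show False using u(2) wz eq by simp
    qed
  qed
  show ?thesis
  proof (rule equalityI)
    show "nearer x y \<subseteq> nearer w z" by (rule sub[OF assms])
    have "sq X w z y x" by (rule sq_swap[OF sq_rotate[OF sq_rotate[OF assms]]])
    then show "nearer w z \<subseteq> nearer x y" by (rule sub)
  qed
qed

text \<open>The two disjoint edges have four vertices together, so their union is a 2-cube, and its
  chart supplies the cyclic order.\<close>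

lemma opposite_cases:
  assumes "opposite X {x, y} e" "adj X x y"
  obtains z w where "sq X x y z w" "e = {w, z}"
proof -
  have e: "e \<in> X" "card e = 2" "{x, y} \<inter> e = {}" "{x, y} \<union> e \<in> X"
    using assms by (auto simp: opposite_def edges_def)
  then obtain a b where ab: "e = {a, b}" "a \<noteq> b" by (auto simp: card_2_iff)
  let ?C = "{x, y} \<union> e"
  obtain n c where c: "cube_chart X n c ?C" "c {} = x"
    by (rule rebased_chart[OF e(4), of x]) simp_all
  have "x \<noteq> y" using assms(2) by (simp add: adj_def)
  then have "card ?C = 4" using e(3) ab by auto
  moreover have "card (Pow {..<n}) = card ?C"
    using c(1) bij_betw_same_card unfolding cube_chart_def by metis
  ultimately have "(2::nat) ^ n = 2 ^ 2" by (simp add: card_Pow)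
  then have n: "n = 2" by (rule power_inject_exp[THEN iffD1, rotated]) simp
  obtain i where i: "i < n" "y = c {i}"
    using cube_chart_neighbour[OF c(1), of y] assms(2) unfolding c(2) by auto
  \<comment> \<open>The other one of the two coordinates 0 and 1.\<close>
  define j where "j = 1 - i"
  have "i = 0 \<or> i = 1" using i n by linarith
  then have j: "j < n" "i \<noteq> j" "{..<n} = {i, j}" using n by (auto simp: j_def)
  have sq: "sq X x y (c {i, j}) (c {j})"
    using cube_chart_sq[OF c(1), of i j "{}"] i j unfolding c(2) by simp
  have "Pow {..<n} = {{}, {i}, {i, j}, {j}}" unfolding j(3) by auto
  then have "?C = {x, y, c {i, j}, c {j}}"
    using c i by (auto simp: cube_chart_def bij_betw_def)
  then have "e = {c {j}, c {i, j}}" using e(3) sq_distinct[OF sq] by auto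
  then show thesis using that sq by blast
qed

lemma sq_opposite:
  assumes "sq X x y z w"
  shows "opposite X {x, y} {w, z}"
  using assms sq_adj[OF assms]
  by (auto simp: opposite_def edges_def sq_def adj_def insert_commute)

lemma hyperplane_nearer:
  assumes "(opposite X)\<^sup>*\<^sup>* {x, y} e" "adj X x y"
  shows "\<exists>u v. e = {u, v} \<and> adj X u v \<and> nearer u v = nearer x y \<and> nearer v u = nearer y x"
  using assms(1)
proof (induction rule: rtranclp_induct)
  case base
  then show ?case using assms(2) by blast
next
  case (step e e')
  then obtain u v where uv: "e = {u, v}" "adj X u v" "nearer u v = nearer x y" "nearer v u = nearer y x" by blast
  obtain z w where zw: "sq X u v z w" "e' = {w, z}"
    using opposite_cases[OF step(2)[unfolded uv(1)] uv(2)] .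
  have "nearer v u = nearer z w" by (rule nearer_sq[OF sq_swap[OF zw(1)]])
  then show ?case using uv nearer_sq[OF zw(1)] zw(2) sq_adj(7)[OF zw(1)]
    by (intro exI[of _ w] exI[of _ z]) simp
qed

text \<open>The edge is moved towards \<open>x\<close> by induction on \<open>d u x\<close>. A
  neighbour \<open>u'\<close> of \<open>u\<close> closer to \<open>x\<close> is also closer to
  \<open>y\<close>, as is \<open>v\<close>. So the quadrangle condition gives a square across which
  \<open>{u, v}\<close> is opposite to an edge at \<open>u'\<close>.\<close>

lemma crossing_edge:
  assumes "adj X x y" "adj X u v" "u \<in> nearer x y" "v \<notin> nearer x y"
  shows "(opposite X)\<^sup>*\<^sup>* {x, y} {u, v} \<and> nearer u v = nearer x y"
  using assms(2-4)
proof (induction "d u x" arbitrary: u v)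
  case (0 u v)
  have V: "x \<in> V" "y \<in> V" "u \<in> V" "v \<in> V" using adj_in[OF assms(1)] adj_in[OF 0(2)] .
  have "u = x" using d_eq_0 0(1) V by simp
  have "d v x = Suc (d v y)"
    using nearer_iff[OF adj_sym[OF assms(1)] V(4)] nearer_compl[OF assms(1)] 0 V by simp
  moreover have "d v x = 1" using d_adj[OF adj_sym[OF 0(2)]] \<open>u = x\<close> by simp
  ultimately have "v = y" using d_eq_0 V by simp
  then show ?case using \<open>u = x\<close> by simp
next
  case (Suc k u v)
  note uv = Suc.prems
  have V: "x \<in> V" "y \<in> V" "u \<in> V" "v \<in> V" using adj_in[OF assms(1)] adj_in[OF uv(1)] .
  have u: "d u y = Suc (d u x)" using nearer_iff[OF assms(1) V(3)] uv by simp
  have v: "d v x = Suc (d v y)"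
    using nearer_iff[OF adj_sym[OF assms(1)] V(4)] nearer_compl[OF assms(1)] uv V by simp
  have vy: "d v y = d u x" "d v x = Suc (d u x)"
    using u v d_adj_cases[OF uv(1) V(1)] d_adj_cases[OF uv(1) V(2)] by linarith+
  obtain u' where u': "adj X u u'" "d u' x = k"
    using descend[OF V(3) V(1)] Suc.hyps(2) by metis
  have u'V: "u' \<in> V" using adj_in[OF u'(1)] by simp
  have u'y: "d u' y = Suc k"
    using d_adj_cases[OF u'(1) V(2)] d_triangle[OF u'V V(1) V(2)] d_adj[OF assms(1)] u u'(2)
      Suc.hyps(2) by linarith
  have "u' \<in> nearer x y" using nearer_iff[OF assms(1) u'V] u'(2) u'y by simp
  then have "v \<noteq> u'" using uv by blast
  have "d u y = Suc (d v y)" "d u y = Suc (d u' y)"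
    using u vy u'y Suc.hyps(2) by simp_all
  from quadrangle[OF uv(1) u'(1) \<open>v \<noteq> u'\<close> V(2) this] obtain v'
    where v': "sq X u v v' u'" "d v y = Suc (d v' y)" by blast
  have v'V: "v' \<in> V" using adj_in[OF sq_adj(3)[OF v'(1)]] by simp
  have "d v' x \<noteq> d v' y \<longrightarrow> d v' x > d v' y"
    using d_adj_cases[OF sq_adj(2)[OF v'(1)] V(1)] vy v'(2) by auto
  then have "v' \<notin> nearer x y" by (auto simp: nearer_def)
  moreover have "adj X u' v'" by (rule sq_adj(7)[OF v'(1)])
  ultimately have IH: "(opposite X)\<^sup>*\<^sup>* {x, y} {u', v'} \<and> nearer u' v' = nearer x y"
    using Suc.hyps(1) u'(2) \<open>u' \<in> nearer x y\<close> by blast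
  have "sq X u' v' v u" by (rule sq_swap[OF sq_rotate[OF sq_rotate[OF v'(1)]]])
  then show ?case using IH sq_opposite nearer_sq rtranclp.rtrancl_into_rtrancl by metis
qed

lemma hyperplane_iff:
  assumes "adj X x y" "adj X u v"
  shows "{u, v} \<in> hyperplane_of X {x, y} \<longleftrightarrow> (u \<in> nearer x y \<longleftrightarrow> v \<notin> nearer x y)"
proof
  assume "{u, v} \<in> hyperplane_of X {x, y}"
  then have "(opposite X)\<^sup>*\<^sup>* {x, y} {u, v}" by (simp add: hyperplane_of_def)
  from hyperplane_nearer[OF this assms(1)] obtain u' v'
    where "{u, v} = {u', v'}" "adj X u' v'" "nearer u' v' = nearer x y" by blast
  then show "u \<in> nearer x y \<longleftrightarrow> v \<notin> nearer x y"
    using nearer_ends[of u' v'] by (auto simp: doubleton_eq_iff)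
next
  assume "u \<in> nearer x y \<longleftrightarrow> v \<notin> nearer x y"
  then have "(opposite X)\<^sup>*\<^sup>* {x, y} {u, v} \<or> (opposite X)\<^sup>*\<^sup>* {x, y} {v, u}"
    using crossing_edge[OF assms] crossing_edge[OF assms(1) adj_sym[OF assms(2)]] by blast
  then show "{u, v} \<in> hyperplane_of X {x, y}"
    by (auto simp: hyperplane_of_def insert_commute)
qed

text \<open>Descending from any vertex of \<open>nearer x y\<close> towards \<open>x\<close> never
  leaves this set, so it is connected without crossing the hyperplane. By
  \<open>hyperplane_iff\<close> it can be left only by crossing.\<close>

lemma component_nearer:
  assumes "adj X x y" "a \<in> nearer x y"
  shows "component_avoiding X (hyperplane_of X {x, y}) a = nearer x y"
proof -
  define R where "R = (\<lambda>u v. adj X u v \<and> {u, v} \<notin> hyperplane_of X {x, y})"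
  have R: "R u v \<longleftrightarrow> adj X u v \<and> (u \<in> nearer x y \<longleftrightarrow> v \<in> nearer x y)" for u v
    using hyperplane_iff[OF assms(1), of u v] unfolding R_def by blast
  have to_x: "R\<^sup>*\<^sup>* v x \<and> R\<^sup>*\<^sup>* x v" if "v \<in> nearer x y" for v
    using that
  proof (induction "d v x" arbitrary: v)
    case (0 v)
    then have "v = x" using d_eq_0[of v x] nearer_subset[of x y] adj_in[OF assms(1)] by auto
    then show ?case by simp
  next
    case (Suc k v)
    have V: "v \<in> V" "x \<in> V" "y \<in> V"
      using subsetD[OF nearer_subset Suc.prems] adj_in[OF assms(1)] by simp_all
    obtain u where u: "adj X v u" "d u x = k" using descend[OF V(1,2)] Suc.hyps(2) by metis
    have "d v y = Suc (d v x)" using nearer_iff[OF assms(1) V(1)] Suc.prems by simp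
    then have "d u x < d u y"
      using d_adj_cases[OF u(1) V(3)] u(2) Suc.hyps(2) by auto
    then have uW: "u \<in> nearer x y" using adj_in[OF u(1)] by (simp add: nearer_def)
    have "R v u" "R u v" using R uW Suc.prems u(1) adj_sym[OF u(1)] by simp_all
    moreover have "R\<^sup>*\<^sup>* u x" "R\<^sup>*\<^sup>* x u"
      using Suc.hyps(1)[OF u(2)[symmetric] uW] by simp_all
    ultimately show ?case
      using converse_rtranclp_into_rtranclp[of R v u x] rtranclp.rtrancl_into_rtrancl[of R x u v]
      by simp
  qed
  have "v \<in> nearer x y" if "R\<^sup>*\<^sup>* a v" for v
    using that by (induction rule: rtranclp_induct) (use assms(2) R in auto)
  moreover have "R\<^sup>*\<^sup>* a v" if "v \<in> nearer x y" for v
    using to_x[OF assms(2)] to_x[OF that] rtranclp_trans[of R a x v] by simp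
  ultimately show ?thesis unfolding component_avoiding_def R_def[symmetric] by blast
qed

lemma sides_eq:
  assumes "adj X x y"
  shows "sides X (hyperplane_of X {x, y}) = {nearer x y, nearer y x}"
proof -
  have "component_avoiding X (hyperplane_of X {x, y}) a = (if a \<in> nearer x y then nearer x y else nearer y x)"
    if "a \<in> V" for a
    using component_nearer[OF assms] component_nearer[OF adj_sym[OF assms]] nearer_compl[OF assms] that
    by (auto simp: insert_commute)
  moreover have "x \<in> V" "y \<in> V" "x \<in> nearer x y" "y \<notin> nearer x y"
    using adj_in[OF assms] nearer_ends[OF assms] by auto
  ultimately show ?thesis unfolding sides_def
    by (auto simp: image_iff)
qed

lemma halfspaces_eq: "halfspaces X = {nearer x y | x y. adj X x y}"
proof (intro equalityI subsetI)
  fix H assume "H \<in> halfspaces X"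
  then obtain e where e: "e \<in> edges X" "H \<in> sides X (hyperplane_of X e)"
    by (auto simp: halfspaces_def hyperplanes_def)
  then obtain x y where "e = {x, y}" "adj X x y"
    by (auto simp: edges_def card_2_iff adj_def)
  then show "H \<in> {nearer x y | x y. adj X x y}"
    using e(2) sides_eq[of x y] adj_sym[of X x y] by auto
next
  fix H assume "H \<in> {nearer x y | x y. adj X x y}"
  then obtain x y where H: "H = nearer x y" "adj X x y" by blast
  then have "{x, y} \<in> edges X" by (auto simp: adj_def edges_def)
  then show "H \<in> halfspaces X"
    using sides_eq[OF H(2)] H(1) by (auto simp: halfspaces_def hyperplanes_def)
qed

lemma opp_nearer: "adj X x y \<Longrightarrow> opp_halfspace X (nearer x y) = nearer y x"
  by (simp add: opp_halfspace_def nearer_compl)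

lemma dual_halfspaces_eq:
  assumes "adj X x y"
  shows "dual_halfspaces X x y = {nearer y x}"
  using nearer_ends[OF assms] nearer_ends[OF adj_sym[OF assms]]
  by (auto simp: dual_halfspaces_def sides_eq[OF assms])

lemma halfspace_crossing:
  assumes "H \<in> halfspaces X" "adj X u v" "u \<in> H" "v \<notin> H"
  shows "H = nearer u v"
proof -
  obtain x y where "H = nearer x y" "adj X x y" using assms(1) unfolding halfspaces_eq by blast
  then show ?thesis using crossing_edge[of x y u v] assms by simp
qed

end

declare Union_iff [simp del] \<comment> \<open>keeps membership in the vertex set folded\<close>

section \<open>Separation by half-spaces and their convexity\<close>

context CAT0
begin

lemma halfspace_subset: "H \<in> halfspaces X \<Longrightarrow> H \<subseteq> V"
  using nearer_subset by (auto simp: halfspaces_eq)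

lemma opp_halfspace_in:
  assumes "H \<in> halfspaces X"
  shows "opp_halfspace X H \<in> halfspaces X"
proof -
  obtain x y where H: "H = nearer x y" "adj X x y" using assms halfspaces_eq by auto
  show ?thesis unfolding H(1) opp_nearer[OF H(2)] halfspaces_eq using adj_sym[OF H(2)] by blast
qed

lemma opp_opp: "H \<in> halfspaces X \<Longrightarrow> opp_halfspace X (opp_halfspace X H) = H"
  using halfspace_subset[of H] by (auto simp: opp_halfspace_def)

definition separating :: "'a \<Rightarrow> 'a \<Rightarrow> 'a set set" where
  "separating x y = {H \<in> halfspaces X. x \<in> H \<and> y \<notin> H}"

text \<open>A path must leave each separating half-space along some edge, and by
  \<open>halfspace_crossing\<close> an edge leaves only one half-space.\<close>

lemma separating_path:
  "edge_path X p \<Longrightarrow> finite (separating (hd p) (last p)) \<and>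
     card (separating (hd p) (last p)) \<le> length p - 1"
\<comment> \<open>The rule serves here as list induction with the cases of no, one, and at least two
  vertices.\<close>
proof (induction p rule: nf.induct)
  case (2 x)
  have "separating x x = {}" by (auto simp: separating_def)
  then show ?case by simp
next
  case (3 x y p)
  let ?b = "last (y # p)"
  have adj: "adj X x y" using 3(2) by simp
  have sub: "separating x ?b \<subseteq> insert (nearer x y) (separating y ?b)"
  proof
    fix H assume "H \<in> separating x ?b"
    then show "H \<in> insert (nearer x y) (separating y ?b)"
      using halfspace_crossing[OF _ adj, of H] by (cases "y \<in> H") (simp_all add: separating_def)
  qed
  have IH: "finite (separating y ?b)" "card (separating y ?b) \<le> length p"
    using 3 by simp_all
  then have "finite (separating x ?b)" using sub finite_subset by blast
  moreover have "card (separating x ?b) \<le> card (insert (nearer x y) (separating y ?b))"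
    using sub IH(1) by (intro card_mono) auto
  then have "card (separating x ?b) \<le> Suc (length p)"
    using IH by (simp add: card_insert_if split: if_splits)
  ultimately show ?case by simp
qed simp

lemma separating_card:
  assumes "x \<in> V" "y \<in> V"
  shows "finite (separating x y)" "card (separating x y) \<le> d x y"
proof -
  obtain p where "edge_path X p" "hd p = x" "last p = y" "length p = Suc (d x y)"
    using d_path assms by blast
  then show "finite (separating x y)" "card (separating x y) \<le> d x y"
    using separating_path[of p] by simp_all
qed

text \<open>This is convexity: a geodesic that has left \<open>H\<close> does not return. Along a
  geodesic from \<open>a\<close> to \<open>b\<close>, the first edge leaving \<open>H\<close> also
  leads closer to \<open>c\<close>, so \<open>c\<close> is on its far side.\<close>

lemma halfspace_gate:
  assumes "H \<in> halfspaces X" "b \<notin> H" "b \<in> V" "c \<in> V"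
  shows "a \<in> H \<Longrightarrow> d a c = d a b + d b c \<Longrightarrow> c \<notin> H"
proof (induction "d a b" arbitrary: a)
  case (0 a)
  then show ?case using d_eq_0[of a b] halfspace_subset[OF assms(1)] assms by auto
next
  case (Suc k a)
  have aV: "a \<in> V" using Suc.prems halfspace_subset[OF assms(1)] by blast
  obtain a' where a': "adj X a a'" "d a' b = k"
    using descend[OF aV assms(3)] Suc.hyps(2) by metis
  have a'V: "a' \<in> V" using adj_in[OF a'(1)] by simp
  have le: "d a' c \<le> k + d b c" using d_triangle[OF a'V assms(3,4)] a'(2) by simp
  have ge: "d a c \<le> Suc (d a' c)" using d_triangle[OF aV a'V assms(4)] d_adj[OF a'(1)] by simp
  show ?case
  proof (cases "a' \<in> H")
    case True
    have "d a' c = d a' b + d b c" using le ge Suc a'(2) by linarith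
    then show ?thesis using Suc.hyps(1) a'(2) True by metis
  next
    case False
    have "H = nearer a a'" using halfspace_crossing[OF assms(1) a'(1) Suc.prems(1) False] .
    moreover have "d a' c < d a c" using le Suc by linarith
    ultimately show ?thesis
      using d_sym[OF aV assms(4)] d_sym[OF a'V assms(4)] by (simp add: nearer_def)
  qed
qed

lemma adj_of_d: "x \<in> V \<Longrightarrow> y \<in> V \<Longrightarrow> d x y = 1 \<Longrightarrow> adj X x y"
  using descend[of x y 0] d_eq_0 adj_in(2) by (metis One_nat_def)

end


section \<open>Vertices of minimal displacement\<close>

locale CAT0_hyperbolic = CAT0 +
  fixes f :: "'a \<Rightarrow> 'a"
  assumes f_V: "x \<in> \<Union>X \<Longrightarrow> f x \<in> \<Union>X"
    and f_adj: "adj X x y \<Longrightarrow> adj X (f x) (f y)"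
    and f_d: "x \<in> \<Union>X \<Longrightarrow> y \<in> \<Union>X \<Longrightarrow> cdist X (f x) (f y) = cdist X x y"
    and hyp: "hyperbolic X f"
begin

abbreviation l :: nat where "l \<equiv> translation_distance X f"

abbreviation axis :: "(int \<Rightarrow> 'a) \<Rightarrow> bool" where "axis \<equiv> combinatorial_axis X f"

lemma l_pos: "0 < l"
  using hyp by (simp add: hyperbolic_def)

lemma axis_V: "axis \<gamma> \<Longrightarrow> \<gamma> i \<in> V"
  unfolding combinatorial_axis_def by blast

lemma axis_d: "axis \<gamma> \<Longrightarrow> d (\<gamma> i) (\<gamma> j) = nat \<bar>i - j\<bar>"
  by (simp add: combinatorial_axis_def)

lemma axis_f: "axis \<gamma> \<Longrightarrow> f (\<gamma> i) = \<gamma> (i + int l)"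
  by (simp add: combinatorial_axis_def)

lemma funpow_V: "x \<in> V \<Longrightarrow> (f ^^ m) x \<in> V"
  by (induction m) (simp_all add: f_V)

lemma funpow_d: "x \<in> V \<Longrightarrow> y \<in> V \<Longrightarrow> d ((f ^^ m) x) ((f ^^ m) y) = d x y"
  by (induction m) (simp_all add: f_d funpow_V)

lemma funpow_axis: "axis \<gamma> \<Longrightarrow> (f ^^ m) (\<gamma> i) = \<gamma> (i + int m * int l)"
  by (induction m) (simp_all add: axis_f algebra_simps)

lemma displacement_subadditive:
  assumes "v \<in> V"
  shows "d v ((f ^^ (m * k)) v) \<le> k * d v ((f ^^ m) v)"
proof (induction k)
  case (Suc k)
  let ?a = "(f ^^ (m * k)) v"
  have "d v ((f ^^ (m * Suc k)) v) \<le> d v ((f ^^ m) v) + d ((f ^^ m) v) ((f ^^ (m * Suc k)) v)"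
    using assms funpow_V by (intro d_triangle)
  moreover have "d ((f ^^ m) v) ((f ^^ (m * Suc k)) v) = d v ?a"
    using funpow_d[of v ?a m] assms funpow_V by (simp add: funpow_add)
  ultimately show ?case using Suc by simp
qed (use assms d_self in simp)

text \<open>
  The orbit of \<open>v\<close> stays at bounded distance from the orbit of a point of the axis, so by
  subadditivity its displacement cannot grow at a rate smaller than \<open>l\<close>.
\<close>

lemma minimal_orbit:
  assumes "axis \<gamma>" "v \<in> V" "d v (f v) = l"
  shows "d v ((f ^^ m) v) = m * l"
proof (rule antisym)
  show "d v ((f ^^ m) v) \<le> m * l"
    using displacement_subadditive[OF assms(2), of 1 m] assms(3) by simp
next
  show "m * l \<le> d v ((f ^^ m) v)"
  proof (rule ccontr)
    assume "\<not> m * l \<le> d v ((f ^^ m) v)"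
    then have lt: "Suc (d v ((f ^^ m) v)) \<le> m * l" by simp
    define D where "D = d (\<gamma> 0) v"
    \<comment> \<open>One more than the amount \<open>2 * D\<close> by which the displacement of the
      axis point can exceed that of \<open>v\<close>.\<close>
    define k where "k = 2 * D + 1"
    let ?F = "f ^^ (m * k)"
    have V: "\<gamma> 0 \<in> V" "?F (\<gamma> 0) \<in> V" "?F v \<in> V"
      using axis_V assms funpow_V by auto
    have "k * (m * l) = d (\<gamma> 0) (?F (\<gamma> 0))"
      unfolding funpow_axis[OF assms(1)] axis_d[OF assms(1)]
      by (simp add: nat_mult_distrib algebra_simps)
    also have "\<dots> \<le> D + d v (?F v) + d (?F v) (?F (\<gamma> 0))"
      using d_triangle[OF V(1) assms(2) V(2)] d_triangle[OF assms(2) V(3) V(2)] by (simp add: D_def)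
    also have "d (?F v) (?F (\<gamma> 0)) = D"
      using funpow_d[OF assms(2) V(1)] d_sym[OF assms(2) V(1)] by (simp add: D_def)
    finally have "k * (m * l) \<le> 2 * D + k * d v ((f ^^ m) v)"
      using displacement_subadditive[OF assms(2), of m k] by linarith
    moreover have "k * Suc (d v ((f ^^ m) v)) \<le> k * (m * l)" using lt by (rule mult_le_mono2)
    ultimately have "k \<le> 2 * D" by simp
    then show False by (simp add: k_def)
  qed
qed

text \<open>
  If \<open>f v\<close> left \<open>H\<close>, then so would all later points of the orbit. Transported back to \<open>v\<close>, this
  says that in each period of \<open>\<gamma>\<close> towards its negative end the distance from \<open>v\<close> fails to grow along
  one edge, and hence that it grows too slowly for a geodesic.
\<close>

lemma minimal_forward:
  assumes ax: "axis \<gamma>" and v: "v \<in> V" "d v (f v) = l"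
    and H: "H = nearer (\<gamma> (i + 1)) (\<gamma> i)" and vH: "v \<in> H"
  shows "f v \<in> H"
proof (rule ccontr)
  assume "f v \<notin> H"
  have adj: "adj X (\<gamma> (i + 1)) (\<gamma> i)"
    using axis_d[OF ax] axis_V[OF ax] by (intro adj_of_d) auto
  then have hs: "H \<in> halfspaces X" using H halfspaces_eq by blast
  \<comment> \<open>By \<open>minimal_orbit\<close>, \<open>f v\<close> lies on a geodesic from
    \<open>v\<close> to each later point of its orbit, so convexity of half-spaces applies.\<close>
  have out: "(f ^^ Suc m) v \<notin> H" for m
  proof (rule halfspace_gate[OF hs \<open>f v \<notin> H\<close> f_V[OF v(1)] funpow_V[OF v(1)] vH])
    have "d (f v) ((f ^^ Suc m) v) = d v ((f ^^ m) v)"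
      using f_d[OF v(1) funpow_V[OF v(1)]] by simp
    then show "d v ((f ^^ Suc m) v) = d v (f v) + d (f v) ((f ^^ Suc m) v)"
      unfolding minimal_orbit[OF ax v] v(2) by simp
  qed
  define b where "b j = int (d v (\<gamma> j))" for j
  have b_lip: "b j \<le> b k + \<bar>j - k\<bar>" for j k
    using d_triangle[OF v(1) axis_V[OF ax, of k] axis_V[OF ax, of j]] axis_d[OF ax, of k j]
    by (simp add: b_def)
  \<comment> \<open>The power of \<open>f\<close> shifts the axis by \<open>Suc m\<close> periods,
    so distances from the orbit point to the axis are distances from \<open>v\<close> to shifted
    axis points.\<close>
  have b_inc: "b (i - int (Suc m) * int l) < b (i + 1 - int (Suc m) * int l)" for m
  proof -
    let ?F = "f ^^ Suc m"
    have F: "d (?F v) (\<gamma> j) = d v (\<gamma> (j - int (Suc m) * int l))" for j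
      using funpow_d[OF v(1) axis_V[OF ax], of "Suc m" "j - int (Suc m) * int l"]
      unfolding funpow_axis[OF ax] by simp
    have "?F v \<notin> nearer (\<gamma> (i + 1)) (\<gamma> i)" using out H by simp
    then have "?F v \<in> nearer (\<gamma> i) (\<gamma> (i + 1))"
      using nearer_compl[OF adj] funpow_V[OF v(1)] by blast
    then have "d (?F v) (\<gamma> i) < d (?F v) (\<gamma> (i + 1))" by (simp add: nearer_def)
    then show ?thesis unfolding F b_def by simp
  qed
  \<comment> \<open>Going back one period, \<open>b\<close> rises by at most \<open>l - 1\<close> on
    the first edges and falls by one on the last.\<close>
  have descent: "b (i - int m * int l) \<le> b i + int m * (int l - 2)" for m
  proof (induction m)
    case (Suc m)
    have "b (i - int (Suc m) * int l) + 1 \<le> b (i + 1 - int (Suc m) * int l)"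
      using b_inc[of m] by simp
    also have "\<dots> \<le> b (i - int m * int l) + (int l - 1)"
      using b_lip[of "i + 1 - int (Suc m) * int l" "i - int m * int l"] l_pos
      by (simp add: algebra_simps)
    finally show ?case using Suc by (simp add: algebra_simps)
  qed simp
  \<comment> \<open>The triangle inequality and \<open>descent\<close> together force
    \<open>m\<close> to be at most \<open>b i\<close>, which this choice exceeds by one.\<close>
  define m where "m = Suc (d v (\<gamma> i))"
  have "d (\<gamma> i) (\<gamma> (i - int m * int l)) \<le> d (\<gamma> i) v + d v (\<gamma> (i - int m * int l))"
    using axis_V[OF ax] v(1) by (intro d_triangle)
  then have "int m * int l \<le> b i + b (i - int m * int l)"
    using axis_d[OF ax, of i "i - int m * int l"] d_sym[OF axis_V[OF ax, of i] v(1)]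
    by (simp add: b_def)
  then have "2 * int m \<le> 2 * b i" using descent[of m] by (simp add: algebra_simps)
  then show False by (simp add: m_def b_def)
qed

text \<open>Otherwise \<open>H\<close> would be cut out both by the edge from \<open>w\<close> to
  \<open>v\<close> and by its image under \<open>f\<close>, so a vertex would lie in
  \<open>H\<close> exactly if its image does. But \<open>f\<close> carries
  \<open>\<gamma> i\<close>, which is outside \<open>H\<close>, further along the axis into
  \<open>H\<close>.\<close>

lemma minimal_crossing:
  assumes ax: "axis \<gamma>" and H: "H = nearer (\<gamma> (i + 1)) (\<gamma> i)"
    and adj: "adj X v w" "v \<notin> H" "w \<in> H" and w: "d w (f w) = l"
  shows "f v \<in> H"
proof (rule ccontr)
  assume "f v \<notin> H"
  have V: "v \<in> V" "w \<in> V" using adj_in[OF adj(1)] .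
  have g: "adj X (\<gamma> (i + 1)) (\<gamma> i)"
    using axis_d[OF ax] axis_V[OF ax] by (intro adj_of_d) auto
  then have hs: "H \<in> halfspaces X" using H halfspaces_eq by blast
  have "f w \<in> H" by (rule minimal_forward[OF ax V(2) w H adj(3)])
  then have 1: "H = nearer (f w) (f v)"
    using halfspace_crossing[OF hs adj_sym[OF f_adj[OF adj(1)]]] \<open>f v \<notin> H\<close> by simp
  have 2: "H = nearer w v" using halfspace_crossing[OF hs adj_sym[OF adj(1)]] adj by simp
  have "f (\<gamma> i) \<in> nearer (\<gamma> (i + 1)) (\<gamma> i)"
    unfolding axis_f[OF ax] nearer_def axis_d[OF ax] mem_Collect_eq using axis_V[OF ax] l_pos by simp
  then have "f (\<gamma> i) \<in> nearer (f w) (f v)" using 1 H by simp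
  then have "\<gamma> i \<in> nearer w v"
    using f_d[OF axis_V[OF ax] V(1)] f_d[OF axis_V[OF ax] V(2)] axis_V[OF ax] by (simp add: nearer_def)
  then show False using 2 H nearer_ends(2)[OF g] by simp
qed

section \<open>The positive half-spaces of the axes\<close>

lemma pos_halfspaces_eq:
  "pos_halfspaces X f = {nearer (\<gamma> (i + 1)) (\<gamma> i) | \<gamma> i. axis \<gamma>}"
proof -
  have "dual_halfspaces X (\<gamma> i) (\<gamma> (i + 1)) = {nearer (\<gamma> (i + 1)) (\<gamma> i)}" if "axis \<gamma>" for \<gamma> i
    using axis_d[OF that] axis_V[OF that] by (intro dual_halfspaces_eq adj_of_d) auto
  then show ?thesis unfolding pos_halfspaces_def by blast
qed

lemma pos_halfspaces_subset: "pos_halfspaces X f \<subseteq> halfspaces X"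
proof -
  have "nearer (\<gamma> (i + 1)) (\<gamma> i) \<in> halfspaces X" if "axis \<gamma>" for \<gamma> i
  proof -
    have "adj X (\<gamma> (i + 1)) (\<gamma> i)"
      using axis_d[OF that] axis_V[OF that] by (intro adj_of_d) auto
    then show ?thesis using halfspaces_eq by blast
  qed
  then show ?thesis unfolding pos_halfspaces_eq by blast
qed

end

lemma cube_dim_eq:
  assumes "card C = 2 ^ n"
  shows "cube_dim C = n"
  unfolding cube_dim_def by (rule the_equality) (use assms in simp_all)


section \<open>Projections of cubes of the minimal set\<close>

context CAT0_hyperbolic
begin

abbreviation \<A> :: "'a set set" where "\<A> \<equiv> ess_halfspaces X f"

abbreviation \<phi> :: "'a \<Rightarrow> 'a set set" where "\<phi> \<equiv> ess_projection X f"

lemma ess_halfspaces_iff: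
  "H \<in> \<A> \<longleftrightarrow> H \<in> halfspaces X \<and>
     (H \<in> pos_halfspaces X f \<or> opp_halfspace X H \<in> pos_halfspaces X f)"
proof
  assume "H \<in> \<A>"
  then consider "H \<in> pos_halfspaces X f"
    | K where "K \<in> pos_halfspaces X f" "H = opp_halfspace X K"
    unfolding ess_halfspaces_def by blast
  then show "H \<in> halfspaces X \<and> (H \<in> pos_halfspaces X f \<or> opp_halfspace X H \<in> pos_halfspaces X f)"
  proof cases
    case 1
    then show ?thesis using pos_halfspaces_subset by blast
  next
    case 2
    then have "K \<in> halfspaces X" using pos_halfspaces_subset by blast
    then show ?thesis using opp_halfspace_in[of K] opp_opp[of K] 2 by simp
  qed
next
  assume "H \<in> halfspaces X \<and> (H \<in> pos_halfspaces X f \<or> opp_halfspace X H \<in> pos_halfspaces X f)"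
  then show "H \<in> \<A>"
    using opp_opp[of H] unfolding ess_halfspaces_def by (metis UnI1 UnI2 imageI)
qed

lemma ess_halfspaces_subset: "\<A> \<subseteq> halfspaces X"
  using ess_halfspaces_iff by blast

lemma opp_ess: "H \<in> \<A> \<Longrightarrow> opp_halfspace X H \<in> \<A>"
  using ess_halfspaces_iff[of H] ess_halfspaces_iff[of "opp_halfspace X H"]
    opp_halfspace_in[of H] opp_opp[of H] by metis

lemma mem_opp: "v \<in> V \<Longrightarrow> v \<in> opp_halfspace X H \<longleftrightarrow> v \<notin> H"
  by (simp add: opp_halfspace_def)

lemma mem_\<phi>: "H \<in> \<phi> v \<longleftrightarrow> H \<in> \<A> \<and> v \<in> H"
  using subsetD[OF ess_halfspaces_subset, of H] by (auto simp: ess_projection_def)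

text \<open>The descending chain condition holds because finitely many half-spaces separate two
  vertices: in an infinite chain around \<open>v\<close>, all members after the first would exclude
  some \<open>y\<close> of the first.\<close>

lemma \<phi>_sageev_vertex:
  assumes v: "v \<in> V"
  shows "\<phi> v \<in> sageev_vertices X \<A>"
proof -
  have "\<not> (\<exists>c :: nat \<Rightarrow> 'a set. range c \<subseteq> \<phi> v \<and> (\<forall>n. c (Suc n) \<subset> c n))"
  proof
    assume "\<exists>c :: nat \<Rightarrow> 'a set. range c \<subseteq> \<phi> v \<and> (\<forall>n. c (Suc n) \<subset> c n)"
    then obtain c :: "nat \<Rightarrow> 'a set" where "range c \<subseteq> \<phi> v" "\<forall>n. c (Suc n) \<subset> c n"
      by (elim exE conjE)
    then have c: "c n \<in> \<phi> v" "c (Suc n) \<subset> c n" for n by (simp_all add: image_subset_iff)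
    have mono: "c m \<subset> c n" if "n < m" for n m
      using that
    proof (induction m)
      case (Suc m)
      then show ?case using c(2)[of m] by (metis less_antisym psubset_trans)
    qed simp
    obtain y where y: "y \<in> c 0" "y \<notin> c 1" using c(2)[of 0] by auto
    have hs: "c n \<in> halfspaces X" "v \<in> c n" for n
      using c(1)[of n] subsetD[OF ess_halfspaces_subset, of "c n"] by (simp_all add: mem_\<phi>)
    have "c 0 \<subseteq> V" by (rule halfspace_subset[OF hs(1)])
    then have "y \<in> V" using y by blast
    have "c (Suc n) \<in> separating v y" for n
    proof -
      have "c (Suc n) \<subseteq> c 1" using mono[of 1 "Suc n"] by (cases n) simp_all
      then show ?thesis
        using y hs[of "Suc n"] unfolding separating_def by blast
    qed
    then have "range (\<lambda>n. c (Suc n)) \<subseteq> separating v y" by blast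
    moreover have "inj (\<lambda>n. c (Suc n))"
    proof (rule injI)
      fix m n assume "c (Suc m) = c (Suc n)"
      then show "m = n" using mono[of "Suc m" "Suc n"] mono[of "Suc n" "Suc m"]
        by (cases m n rule: linorder_cases) simp_all
    qed
    ultimately show False
      using separating_card(1)[OF v \<open>y \<in> V\<close>] finite_subset range_inj_infinite by blast
  qed
  moreover have "H \<in> \<phi> v \<longleftrightarrow> opp_halfspace X H \<notin> \<phi> v" if "H \<in> \<A>" for H
    using that opp_ess[OF that] mem_opp[OF v] by (simp add: mem_\<phi>)
  moreover have "\<forall>H\<in>\<phi> v. \<forall>K\<in>\<phi> v. H \<inter> K \<noteq> {}"
    by (auto simp: mem_\<phi>)
  moreover have "\<phi> v \<subseteq> \<A>" by (auto simp: mem_\<phi>)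
  ultimately show ?thesis unfolding sageev_vertices_def by blast
qed

lemma minimal_cube_projection:
  assumes C: "C \<in> minimal_set X f"
  shows "\<phi> ` C \<in> sageev_complex X \<A> \<and> cube_dim (\<phi> ` C) \<le> l"
proof -
  have CX: "C \<in> X" and min: "\<And>v. v \<in> C \<Longrightarrow> d v (f v) = l"
    using C by (auto simp: minimal_set_def)
  have CV: "v \<in> V" if "v \<in> C" for v using CX that by blast
  obtain n c where c: "cube_chart X n c C"
    using CAT0 CX unfolding CAT0_cube_complex_def cube_complex_def by blast
  have cbij: "bij_betw c (Pow {..<n}) C" using c by (simp add: cube_chart_def)
  have cC: "c S \<in> C" if "S \<subseteq> {..<n}" for S
    using cbij that by (auto simp: bij_betw_def)
  note cV = CV[OF cC]
  \<comment> \<open>The half-space that cuts the cube in direction \<open>i\<close> and contains the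
    vertices having coordinate \<open>i\<close>.\<close>
  define D where "D i = nearer (c {i}) (c {})" for i
  have edge: "adj X (c (insert i S)) (c S)" if "i < n" "S \<subseteq> {..<n}" "i \<notin> S" for i S
    using cube_chart_adj[OF c, of i S] that adj_sym by simp
  \<comment> \<open>Parallel edges of the cube are linked by squares, so \<open>nearer_sq\<close>
    shows that they determine the same half-space.\<close>
  have D_edge: "nearer (c (insert i S)) (c S) = D i" if i: "i < n" and "S \<subseteq> {..<n}" "i \<notin> S" for i S
  proof -
    have "finite S" using that(2) finite_subset by blast
    then show ?thesis using that(2,3)
    proof (induction S)
      case (insert j S)
      have "sq X (c (insert i S)) (c S) (c (insert j S)) (c (insert j (insert i S)))"
        by (rule sq_swap[OF cube_chart_sq[OF c, of j i S, THEN sq_flip]]) (use insert i in auto)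
      from nearer_sq[OF this] show ?case using insert by (simp add: insert_commute)
    qed (simp add: D_def)
  qed
  have D_mem: "c S \<in> D i \<longleftrightarrow> i \<in> S" if i: "i < n" and S: "S \<subseteq> {..<n}" for i S
  proof (cases "i \<in> S")
    case True
    have "nearer (c (insert i (S - {i}))) (c (S - {i})) = D i" using S i by (intro D_edge) auto
    moreover have "adj X (c (insert i (S - {i}))) (c (S - {i}))" using S i by (intro edge) auto
    ultimately show ?thesis using nearer_ends(1) True insert_Diff by metis
  next
    case False
    then show ?thesis using nearer_ends(2)[OF edge[OF i S False]] D_edge[OF i S False] by simp
  qed
  have D_hs: "D i \<in> halfspaces X" if "i < n" for i
    using edge[OF that, of "{}"] halfspaces_eq unfolding D_def by auto
  \<comment> \<open>A half-space that separates vertices of the cube separates the ends of one of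
    its edges, and is then given by the direction of that edge.\<close>
  have cases: "(\<exists>i<n. H = D i) \<or> (\<exists>i<n. H = opp_halfspace X (D i)) \<or>
      (\<forall>S \<subseteq> {..<n}. c S \<in> H \<longleftrightarrow> c {} \<in> H)" if H: "H \<in> halfspaces X" for H
  proof (rule ccontr)
    assume neg: "\<not> ?thesis"
    have "c S \<in> H \<longleftrightarrow> c {} \<in> H" if S: "S \<subseteq> {..<n}" for S
    proof -
      have "finite S" using S finite_subset by blast
      then show ?thesis using S
      proof (induction S)
        case (insert i S)
        have i: "i < n" "S \<subseteq> {..<n}" "i \<notin> S" using insert by auto
        note e = edge[OF i]
        have "c (insert i S) \<in> H \<longleftrightarrow> c S \<in> H"
        proof (rule ccontr)
          assume "\<not> ?thesis"
          then have "H = nearer (c (insert i S)) (c S) \<or> H = nearer (c S) (c (insert i S))"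
            using halfspace_crossing[OF H e] halfspace_crossing[OF H adj_sym[OF e]] by blast
          then have "H = D i \<or> H = opp_halfspace X (D i)"
            using D_edge[OF i] opp_nearer[OF e] by simp
          then show False using neg i(1) by blast
        qed
        then show ?case using insert by simp
      qed simp
    qed
    then show False using neg by blast
  qed
  \<comment> \<open>The essential directions. The remaining ones are collapsed by
    \<open>\<phi>\<close>, so the image is a cube of dimension \<open>card I\<close>.\<close>
  define I where "I = {i. i < n \<and> D i \<in> \<A>}"
  have I: "finite I" "I \<subseteq> {..<n}" by (auto simp: I_def)
  have ess_cases: "(\<exists>i\<in>I. H = D i) \<or> (\<exists>i\<in>I. H = opp_halfspace X (D i)) \<or>
      (\<forall>S \<subseteq> {..<n}. c S \<in> H \<longleftrightarrow> c {} \<in> H)" if H: "H \<in> \<A>" for H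
  proof -
    have "i \<in> I" if "i < n" "H = opp_halfspace X (D i)" for i
      using opp_ess[OF H] opp_opp[OF D_hs[OF that(1)]] that by (simp add: I_def)
    moreover have "i \<in> I" if "i < n" "H = D i" for i using that H by (simp add: I_def)
    moreover have "H \<in> halfspaces X" using H ess_halfspaces_subset by blast
    ultimately show ?thesis using cases by blast
  qed
  have \<phi>_inter: "\<phi> (c S) = \<phi> (c (S \<inter> I))" if S: "S \<subseteq> {..<n}" for S
  proof -
    have SI: "S \<inter> I \<subseteq> {..<n}" using S by blast
    have "c S \<in> H \<longleftrightarrow> c (S \<inter> I) \<in> H" if "H \<in> \<A>" for H
      using ess_cases[OF that]
    proof (elim disjE bexE)
      fix i assume "i \<in> I" "H = D i"
      then show ?thesis using D_mem[OF _ S, of i] D_mem[OF _ SI, of i] I(2) by auto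
    next
      fix i assume "i \<in> I" "H = opp_halfspace X (D i)"
      then show ?thesis using D_mem[OF _ S, of i] D_mem[OF _ SI, of i] I(2)
        mem_opp[OF cV[OF S]] mem_opp[OF cV[OF SI]] by auto
    next
      assume "\<forall>S \<subseteq> {..<n}. c S \<in> H \<longleftrightarrow> c {} \<in> H"
      then show ?thesis using S SI by blast
    qed
    then show ?thesis by (auto simp: mem_\<phi>)
  qed
  have \<phi>_inj: "S = T" if "S \<subseteq> I" "T \<subseteq> I" "\<phi> (c S) = \<phi> (c T)" for S T
  proof -
    have "i \<in> S \<longleftrightarrow> i \<in> T" if "i \<in> I" for i
    proof -
      have "D i \<in> \<A>" "i < n" using that by (auto simp: I_def)
      then have "D i \<in> \<phi> (c S) \<longleftrightarrow> i \<in> S" "D i \<in> \<phi> (c T) \<longleftrightarrow> i \<in> T"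
        using D_mem[of i] \<open>S \<subseteq> I\<close> \<open>T \<subseteq> I\<close> I(2) by (auto simp: mem_\<phi>)
      then show ?thesis using \<open>\<phi> (c S) = \<phi> (c T)\<close> by simp
    qed
    then show ?thesis using that by blast
  qed
  have \<phi>_adj: "sageev_adj X (\<phi> (c S)) (\<phi> (c (insert i S)))" if S: "S \<subseteq> I" and i: "i \<in> I - S" for S i
  proof -
    have n: "i < n" "S \<subseteq> {..<n}" "insert i S \<subseteq> {..<n}" "i \<notin> S" and DA: "D i \<in> \<A>"
      using S i I(2) by (auto simp: I_def)
    let ?H = "opp_halfspace X (D i)"
    have oo: "opp_halfspace X ?H = D i" by (rule opp_opp[OF D_hs[OF n(1)]])
    have Hi: "?H \<in> \<phi> (c S)"
      using opp_ess[OF DA] mem_opp[OF cV[OF n(2)]] D_mem[OF n(1,2)] n(4) by (simp add: mem_\<phi>)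
    have Hni: "?H \<notin> \<phi> (c (insert i S))"
      using mem_opp[OF cV[OF n(3)]] D_mem[OF n(1,3)] by (simp add: mem_\<phi>)
    have Di: "D i \<in> \<phi> (c (insert i S))" using DA D_mem[OF n(1,3)] by (simp add: mem_\<phi>)
    have Dni: "D i \<notin> \<phi> (c S)" using D_mem[OF n(1,2)] n(4) by (simp add: mem_\<phi>)
    have other: "K \<in> \<phi> (c (insert i S)) \<longleftrightarrow> K \<in> \<phi> (c S)" if "K \<noteq> D i" "K \<noteq> ?H" for K
    proof -
      have "c (insert i S) \<in> K \<longleftrightarrow> c S \<in> K" if "K \<in> \<A>"
        using halfspace_crossing[of K, OF _ edge[OF n(1,2,4)]]
          halfspace_crossing[of K, OF _ adj_sym[OF edge[OF n(1,2,4)]]]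
          subsetD[OF ess_halfspaces_subset that] \<open>K \<noteq> D i\<close> \<open>K \<noteq> ?H\<close>
          opp_nearer[OF edge[OF n(1,2,4)]] unfolding D_edge[OF n(1,2,4)] by metis
      then show ?thesis by (auto simp: mem_\<phi>)
    qed
    have "\<phi> (c (insert i S)) = insert (D i) (\<phi> (c S) - {?H})"
    proof (rule Set.set_eqI)
      fix K show "K \<in> \<phi> (c (insert i S)) \<longleftrightarrow> K \<in> insert (D i) (\<phi> (c S) - {?H})"
        using other[of K] Di Hni by blast
    qed
    then have "\<phi> (c (insert i S)) = insert (opp_halfspace X ?H) (\<phi> (c S) - {?H})"
      unfolding oo .
    then show ?thesis unfolding sageev_adj_def using Hi by (rule bexI)
  qed
  \<comment> \<open>Numbering the essential directions turns subsets of \<open>I\<close> into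
    coordinates of a cube chart for the image.\<close>
  obtain e where e: "bij_betw e {..<card I} I"
    using ex_bij_betw_nat_finite[OF I(1)] by (auto simp: atLeast0LessThan)
  have e_inj: "inj_on e {..<card I}" and e_im: "e ` {..<card I} = I"
    using e by (auto simp: bij_betw_def)
  have e_sub: "e ` T \<subseteq> I" if "T \<subseteq> {..<card I}" for T using e_im that by blast
  have bij: "bij_betw (\<lambda>T. \<phi> (c (e ` T))) (Pow {..<card I}) (\<phi> ` C)"
  proof (rule bij_betw_imageI[OF inj_onI])
    fix S T assume ST: "S \<in> Pow {..<card I}" "T \<in> Pow {..<card I}" "\<phi> (c (e ` S)) = \<phi> (c (e ` T))"
    then have "e ` S = e ` T" using \<phi>_inj e_sub by simp
    then show "S = T" using inj_on_image_eq_iff[OF e_inj] ST by simp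
  next
    show "(\<lambda>T. \<phi> (c (e ` T))) ` Pow {..<card I} = \<phi> ` C"
    proof (intro equalityI subsetI)
      fix v assume "v \<in> (\<lambda>T. \<phi> (c (e ` T))) ` Pow {..<card I}"
      then show "v \<in> \<phi> ` C" using cC e_sub I(2) by blast
    next
      fix v assume "v \<in> \<phi> ` C"
      then obtain x where x: "x \<in> C" "v = \<phi> x" by blast
      then obtain S where S: "S \<subseteq> {..<n}" "x = c S" using cbij by (auto simp: bij_betw_def)
      have "S \<inter> I \<subseteq> e ` {..<card I}" using e_im by blast
      then obtain T where "T \<subseteq> {..<card I}" "S \<inter> I = e ` T" by (metis subset_image_iff)
      then show "v \<in> (\<lambda>T. \<phi> (c (e ` T))) ` Pow {..<card I}"
        using \<phi>_inter[OF S(1)] S(2) x(2) by auto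
    qed
  qed
  have "sageev_adj X (\<phi> (c (e ` S))) (\<phi> (c (e ` insert i S)))"
    if "S \<subseteq> {..<card I}" "i \<in> {..<card I} - S" for S i
  proof -
    have "e i \<in> I - e ` S" using e_inj e_im that by (auto simp: inj_on_def)
    then show ?thesis using \<phi>_adj[OF e_sub[OF that(1)]] by simp
  qed
  then have "\<exists>(m::nat) c'. bij_betw c' (Pow {..<m}) (\<phi> ` C) \<and>
       (\<forall>S \<subseteq> {..<m}. \<forall>i \<in> {..<m} - S. sageev_adj X (c' S) (c' (insert i S)))"
    using bij by (intro exI[of _ "card I"] exI[of _ "\<lambda>T. \<phi> (c (e ` T))"]) blast
  moreover have "\<phi> ` C \<subseteq> sageev_vertices X \<A>" using CV \<phi>_sageev_vertex by blast
  ultimately have complex: "\<phi> ` C \<in> sageev_complex X \<A>"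
    unfolding sageev_complex_def by blast

  \<comment> \<open>The positively oriented one of the two half-spaces in direction
    \<open>i\<close>.\<close>
  define E where "E i = (if D i \<in> pos_halfspaces X f then D i else opp_halfspace X (D i))" for i
  have E_pos: "E i \<in> pos_halfspaces X f" if "i \<in> I" for i
    using that ess_halfspaces_iff[of "D i"] by (auto simp: E_def I_def)
  \<comment> \<open>The vertex \<open>c S0\<close> lies outside all the positive half-spaces \<open>E i\<close>.\<close>
  define S0 where "S0 = {i \<in> I. D i \<notin> pos_halfspaces X f}"
  have S0: "S0 \<subseteq> {..<n}" using I(2) by (auto simp: S0_def)
  have E_mem: "c S \<in> E i \<longleftrightarrow> (i \<in> S \<longleftrightarrow> i \<notin> S0)" if "i \<in> I" "S \<subseteq> {..<n}" for i S
    using D_mem[of i S] mem_opp[OF cV[OF that(2)]] that I(2) by (auto simp: E_def S0_def)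
  have E_sep: "E i \<in> separating (f (c S0)) (c S0)" if i: "i \<in> I" for i
  proof -
    have n: "i < n" using i I(2) by auto
    \<comment> \<open>The neighbour of the vertex \<open>S0\<close> in direction \<open>i\<close>,
      obtained by flipping coordinate \<open>i\<close>.\<close>
    define S1 where "S1 = (if i \<in> S0 then S0 - {i} else insert i S0)"
    have S1: "S1 \<subseteq> {..<n}" using S0 n by (auto simp: S1_def)
    have adj: "adj X (c S0) (c S1)"
    proof (cases "i \<in> S0")
      case True
      then have "insert i (S0 - {i}) = S0" by blast
      then show ?thesis using edge[OF n, of "S0 - {i}"] S0 True by (auto simp: S1_def)
    next
      case False
      then show ?thesis using adj_sym[OF edge[OF n S0 False]] by (simp add: S1_def)
    qed
    have "c S0 \<notin> E i" "c S1 \<in> E i"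
      using E_mem[OF i S0] E_mem[OF i S1] by (auto simp: S1_def)
    moreover obtain \<gamma> k where "axis \<gamma>" "E i = nearer (\<gamma> (k + 1)) (\<gamma> k)"
      using E_pos[OF i] unfolding pos_halfspaces_eq by blast
    ultimately have "f (c S0) \<in> E i"
      using minimal_crossing adj min[OF cC[OF S1]] by blast
    then show ?thesis
      using \<open>c S0 \<notin> E i\<close> E_pos[OF i] pos_halfspaces_subset by (auto simp: separating_def)
  qed
  \<comment> \<open>Flipping the single coordinate \<open>i\<close> of \<open>S0\<close> enters
    \<open>E i\<close> and no other of these half-spaces.\<close>
  have "inj_on E I"
  proof (rule inj_onI)
    fix i j assume ij: "i \<in> I" "j \<in> I" "E i = E j"
    let ?S = "if i \<in> S0 then S0 - {i} else insert i S0"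
    have S: "?S \<subseteq> {..<n}" using S0 ij(1) I(2) by auto
    have "c ?S \<in> E i" using E_mem[OF ij(1) S] by auto
    then have "c ?S \<in> E j" using ij(3) by simp
    then show "i = j" using E_mem[OF ij(2) S] by (auto split: if_splits)
  qed
  have v: "c S0 \<in> V" "f (c S0) \<in> V" using cV[OF S0] f_V by simp_all
  \<comment> \<open>The distinct half-spaces \<open>E i\<close> all separate \<open>f (c S0)\<close>
    from \<open>c S0\<close>, two vertices at distance \<open>l\<close>.\<close>
  have "card I = card (E ` I)" using \<open>inj_on E I\<close> by (simp add: card_image)
  also have "\<dots> \<le> card (separating (f (c S0)) (c S0))"
    using E_sep separating_card(1)[OF v(2,1)] by (intro card_mono) auto
  also have "\<dots> \<le> d (f (c S0)) (c S0)" by (rule separating_card(2)[OF v(2,1)])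
  also have "\<dots> = l" using min[OF cC[OF S0]] d_sym[OF v] by simp
  finally have "card I \<le> l" .
  have "card (\<phi> ` C) = 2 ^ card I"
    using bij_betw_same_card[OF bij] by (simp add: card_Pow)
  then have "cube_dim (\<phi> ` C) = card I" by (rule cube_dim_eq)
  with \<open>card I \<le> l\<close> complex show ?thesis by simp
qed

end


section \<open>Cubical actions\<close>

lemma cubical_action_adj:
  assumes "cubical_action G X act" "g \<in> carrier G" "adj X x y"
  shows "adj X (act g x) (act g y)"
proof -
  interpret group_action G "\<Union>X" act using assms(1) by (simp add: cubical_action_def)
  have "act g ` {x, y} \<in> X" using assms by (simp only: cubical_action_def adj_def)
  moreover have "act g x \<noteq> act g y"
    using inj_prop[OF assms(2)] assms(3) adj_in[OF assms(3)]
    by (auto simp: adj_def inj_on_def)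
  ultimately show ?thesis by (simp add: adj_def)
qed

lemma (in CAT0) d_map_le:
  assumes "\<And>x y. adj X x y \<Longrightarrow> adj X (h x) (h y)" "\<And>x. x \<in> V \<Longrightarrow> h x \<in> V"
    and "x \<in> V" "y \<in> V"
  shows "d (h x) (h y) \<le> d x y"
proof -
  obtain p where p: "edge_path X p" "hd p = x" "last p = y" "length p = Suc (d x y)"
    using d_path[OF assms(3,4)] .
  have "edge_path X q \<Longrightarrow> edge_path X (map h q)" for q
    by (induction q rule: nf.induct) (use assms(1,2) in auto)
  then show ?thesis using p by (intro d_le[of "map h p"]) (auto simp: hd_map last_map edge_path_def)
qed

text \<open>Neither \<open>g\<close> nor its inverse increases distances, since both map edge paths
  to edge paths.\<close>

lemma (in CAT0) cubical_action_isometry: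
  assumes "cubical_action G X act" "g \<in> carrier G" "x \<in> V" "y \<in> V"
  shows "d (act g x) (act g y) = d x y"
proof (rule antisym)
  interpret group_action G V act using assms(1) by (simp add: cubical_action_def)
  have le: "d (act h u) (act h w) \<le> d u w" if "h \<in> carrier G" "u \<in> V" "w \<in> V" for h u w
    using cubical_action_adj[OF assms(1) that(1)] element_image[OF that(1) _ refl] that(2,3)
    by (rule d_map_le)
  show "d (act g x) (act g y) \<le> d x y" using le assms by blast
  let ?i = "inv\<^bsub>G\<^esub> g"
  have "?i \<in> carrier G" using assms(2) group_hom group_hom.axioms(1) group.inv_closed by metis
  moreover have "act ?i (act g u) = u" if "u \<in> V" for u
    using orbit_sym_aux[OF assms(2) that refl] .
  moreover have "act g u \<in> V" if "u \<in> V" for u using element_image[OF assms(2) that refl] .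
  ultimately show "d x y \<le> d (act g x) (act g y)"
    using le[of ?i "act g x" "act g y"] assms by simp
qed

theorem lemma3p14:
  fixes G :: "('g, 'm) monoid_scheme"
    and X :: "'a set set"
    and act :: "'g \<Rightarrow> 'a \<Rightarrow> 'a"
    and g :: 'g
  assumes "CAT0_cube_complex X"
    and "cubical_action G X act"
    and "without_inversion G X act"
    and "g \<in> carrier G"
    and "hyperbolic X (act g)"
  shows "ess_minimal_set X (act g) \<subseteq> ess_characteristic_set X (act g) \<and>
    finite_dimensional (ess_minimal_set X (act g)) \<and>
    complex_dim (ess_minimal_set X (act g)) \<le> enat (translation_distance X (act g))"
proof -
  interpret CAT0 X by unfold_locales (rule assms(1))
  interpret CAT0_hyperbolic X "act g"
  proof unfold_locales
    fix x y
    show "act g x \<in> \<Union>X" if "x \<in> \<Union>X"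
      using group_action.element_image[of G "\<Union>X" act g x "act g x"] assms(2,4) that
      unfolding cubical_action_def by simp
    show "adj X (act g x) (act g y)" if "adj X x y"
      using cubical_action_adj[OF assms(2,4) that] .
    show "d (act g x) (act g y) = d x y" if "x \<in> \<Union>X" "y \<in> \<Union>X"
      using cubical_action_isometry[OF assms(2,4) that] .
  qed (rule assms(5))
  have proj: "M \<in> ess_characteristic_set X (act g) \<and> cube_dim M \<le> l"
    if "M \<in> ess_minimal_set X (act g)" for M
    using that minimal_cube_projection
    unfolding ess_minimal_set_def ess_characteristic_set_def by blast
  then have "finite_dimensional (ess_minimal_set X (act g))"
    unfolding finite_dimensional_def by blast
  moreover have "complex_dim (ess_minimal_set X (act g)) \<le> enat l"
    unfolding complex_dim_def using proj by (intro SUP_least) simp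
  ultimately show ?thesis using proj by blast
qed

end
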